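(* Let $n$ be a fixed nonnegative integer, let $f_0,\dots,f_n$ be given entire functions that are real-valued on the real line, let $\eta_0,\dots,\eta_n$ be independent identically distributed $N(0,1)$ random variables, and let $P_n(z)=\sum_{j=0}^n \eta_j f_j(z)$ for $z\in\mathbb{C}$. For a set $\Omega$ in the complex plane let $\nu_n(\Omega)$ denote the (random) number of zeros of $P_n$ in $\Omega$. On the real line, the function $D_0$ vanishes. For each measurable set $\Omega\subset\mathbb{R}$, $$\mathbf{E}\,\nu_n(\Omega)=\int_\Omega g_n(x)\,dx,\qquad\text{where}\qquad g_n(x)=\frac{E_1(x)}{\pi B_0(x)}.$$
   Context: Here $A_0(z)=\sum_{j=0}^n f_j(z)^2$, $A_1(z)=\sum_{j=0}^n f_j(z)f_j'(z)$, $A_2(z)=\sum_{j=0}^n f_j'(z)^2$, $B_0(z)=\sum_{j=0}^n |f_j(z)|^2$, $D_0(z)=\sqrt{B_0(z)^2-|A_0(z)|^2}$, and $E_1(z)=\sqrt{A_2(z)A_0(z)-A_1(z)^2}$. Regarding the branch of the square root in $E_1$, the paper remarks that $E_1$ will only be needed in places where the argument of the square root is a positive real, and that at such places the square root is taken to be a positive real; this is a remark on the definition of $E_1$, not a restriction on $\Omega$. Primes denote differentiation with respect to $z$. The symbol $\mathbf{E}$ denotes expectation.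
   Formalization: The formula is stated for measurable sets Ω of reals containing no common zero of f_0,…,f_n (B_0 ≠ 0 on Ω); otherwise g_n is undefined there and the formula fails, e.g. n = 0, f_0(z) = z, Ω = {0}, where the expected count is 1 and the integral is 0. *)

theory Defs
  imports "HOL-Probability.Probability" "HOL-Complex_Analysis.Complex_Analysis"
begin

definition A0 :: "nat \<Rightarrow> (nat \<Rightarrow> complex \<Rightarrow> complex) \<Rightarrow> complex \<Rightarrow> complex" where
  "A0 n f z = (\<Sum>j\<le>n. (f j z)\<^sup>2)"

definition A1 :: "nat \<Rightarrow> (nat \<Rightarrow> complex \<Rightarrow> complex) \<Rightarrow> complex \<Rightarrow> complex" where
  "A1 n f z = (\<Sum>j\<le>n. f j z * deriv (f j) z)"

definition A2 :: "nat \<Rightarrow> (nat \<Rightarrow> complex \<Rightarrow> complex) \<Rightarrow> complex \<Rightarrow> complex" where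
  "A2 n f z = (\<Sum>j\<le>n. (deriv (f j) z)\<^sup>2)"

definition B0 :: "nat \<Rightarrow> (nat \<Rightarrow> complex \<Rightarrow> complex) \<Rightarrow> complex \<Rightarrow> real" where
  "B0 n f z = (\<Sum>j\<le>n. (cmod (f j z))\<^sup>2)"

definition D0 :: "nat \<Rightarrow> (nat \<Rightarrow> complex \<Rightarrow> complex) \<Rightarrow> complex \<Rightarrow> real" where
  "D0 n f z = sqrt ((B0 n f z)\<^sup>2 - (cmod (A0 n f z))\<^sup>2)"

(* csqrt is the principal branch, so it takes a positive real to its positive real root. *)
definition E1 :: "nat \<Rightarrow> (nat \<Rightarrow> complex \<Rightarrow> complex) \<Rightarrow> complex \<Rightarrow> complex" where
  "E1 n f z = csqrt (A2 n f z * A0 n f z - (A1 n f z)\<^sup>2)"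

(* If the f j are real on the real line, the radicand of E1 at a real point is a nonnegative
   real by the Cauchy-Schwarz inequality, so the quotient is real and Re only changes its type. *)
definition g_density :: "nat \<Rightarrow> (nat \<Rightarrow> complex \<Rightarrow> complex) \<Rightarrow> real \<Rightarrow> real" where
  "g_density n f x = Re (E1 n f (of_real x) / of_real (pi * B0 n f (of_real x)))"

definition random_sum ::
  "nat \<Rightarrow> (nat \<Rightarrow> complex \<Rightarrow> complex) \<Rightarrow> (nat \<Rightarrow> 'w \<Rightarrow> real) \<Rightarrow> 'w \<Rightarrow> complex \<Rightarrow> complex" where
  "random_sum n f \<eta> \<omega> z = (\<Sum>j\<le>n. of_real (\<eta> j \<omega>) * f j z)"

(* Meant for an entire function h and a zero z of h. The constant function 0, for which zorder
   is unspecified, vanishes to infinite order everywhere. *)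
definition zero_multiplicity :: "(complex \<Rightarrow> complex) \<Rightarrow> complex \<Rightarrow> ennreal" where
  "zero_multiplicity h z =
     (if \<forall>w. h w = 0 then \<infinity> else ennreal (real_of_int (zorder h z)))"

(* Number of zeros in S, counted with multiplicity; it can be infinite. *)
definition zero_count :: "(complex \<Rightarrow> complex) \<Rightarrow> complex set \<Rightarrow> ennreal" where
  "zero_count h S = (\<integral>\<^sup>+z. zero_multiplicity h z \<partial>count_space {z \<in> S. h z = 0})"

end

theory Submission
  imports Defs
begin

text \<open>Let \<open>r j\<close> be the restriction of \<open>f j\<close> to the real line. Where \<open>r k\<close> does not vanish,
  \<open>x\<close> is a zero of the random sum iff \<open>\<eta> k = h x\<close>, where \<open>h\<close> is minus the sum of the
  \<open>\<eta> j * (r j / r k)\<close> over \<open>j \<noteq> k\<close> and so is independent of \<open>\<eta> k\<close>. Integrating first over \<open>\<eta> k\<close>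
  and applying the area formula to \<open>h\<close>, the expected number of zeros in \<open>A\<close> becomes the
  integral over \<open>A\<close> of the expectation of \<open>\<phi> (h x) * \<bar>h' x\<bar>\<close>, with \<open>\<phi>\<close> the standard normal
  density. As \<open>(h x, h' x)\<close> is a Gaussian pair, rotation invariance gives this expectation in
  closed form. Double zeros correspond to \<open>\<eta> k\<close> being a critical value of \<open>h\<close>, which by
  Sard's theorem has probability zero.\<close>

section \<open>The area formula on the line\<close>

text \<open>At a common zero of all the \<open>f j\<close> every realisation of the random sum
  vanishes, so such a point carries at least one expected zero although it has Lebesgue measure 0.
  The identity is therefore stated for sets on which \<open>B0\<close> is nonzero, which are exactly
  the sets covered by the \<open>U k\<close>. One \<open>k\<close> need not serve for the whole set;
  different \<open>k\<close> are used on different pieces, and these fit together because the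
  density found with \<open>k\<close> turns out not to depend on \<open>k\<close>. The other
  obstacle is measurability. Integrating first over one coefficient requires the number of zeros to
  be a measurable function of all coefficients, which is not visible for the size of a random set.
  Half-open intervals are treated by hand and general Borel sets by a Dynkin argument. Likewise the
  event of a double zero has to be measurable before its probability can be computed one coefficient
  at a time. The factor 1/\<pi> in the density is the product of \<open>std_normal_density 0\<close>
  and the mean modulus \<open>sqrt (2 / pi)\<close> of a standard normal variable.\<close>

lemma negligible_critical_values:
  fixes h :: "real \<Rightarrow> real"
  assumes "\<And>x. x \<in> S \<Longrightarrow> (h has_real_derivative 0) (at x)"
  shows "negligible (h ` S)"
proof -
  \<comment> \<open>Sard's theorem is available for maps between spaces \<open>real^'m\<close> and
    \<open>real^'n\<close> and asks for deficient rank. On \<open>real^1\<close> a vanishing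
    derivative has rank 0 < 1. The coordinate projection, being differentiable, carries the
    negligible image back to the line.\<close>
  define F :: "real^1 \<Rightarrow> real^1" where "F = (\<lambda>x. vec (h (x $ 1)))"
  define S' :: "(real^1) set" where "S' = {x. x $ 1 \<in> S}"
  have "(F has_derivative (\<lambda>_. 0)) (at x within S')" if "x \<in> S'" for x
  proof -
    have h: "(h has_derivative (\<lambda>_. 0)) (at (x $ 1))"
      using assms[of "x $ 1"] that
      by (simp add: S'_def has_field_derivative_def lambda_zero)
    have 1: "((\<lambda>x::real^1. x $ 1) has_derivative (\<lambda>x. x $ 1)) (at x within S')"
      by (intro bounded_linear_imp_has_derivative bounded_linear_vec_nth)
    have 2: "((\<lambda>x::real^1. h (x $ 1)) has_derivative (\<lambda>_. 0)) (at x within S')"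
      using has_derivative_compose[OF 1 h] by simp
    have 3: "bounded_linear (vec :: real \<Rightarrow> real^1)"
      by (simp add: linear_linear linear_vec)
    show ?thesis
      using bounded_linear.has_derivative[OF 3 2] by (simp add: F_def)
  qed
  moreover have "rank (matrix (\<lambda>_::real^1. 0::real^1)) < CARD(1)"
  proof -
    have "matrix (\<lambda>_::real^1. 0::real^1) = 0"
      by (simp add: matrix_def vec_eq_iff)
    then show ?thesis by simp
  qed
  ultimately have "negligible (F ` S')"
    by (intro baby_Sard[where f' = "\<lambda>_ _. 0"]) auto
  then have "negligible ((\<lambda>x::real^1. x $ 1) ` F ` S')"
    by (rule negligible_differentiable_image_negligible[rotated])
       (auto intro!: bounded_linear_imp_differentiable_on bounded_linear_vec_nth)
  moreover have "h ` S \<subseteq> (\<lambda>x::real^1. x $ 1) ` F ` S'"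
  proof
    fix y assume "y \<in> h ` S"
    then obtain x where "x \<in> S" "y = h x" by auto
    then have "vec x \<in> S'" "F (vec x) $ 1 = y"
      by (auto simp: S'_def F_def)
    then show "y \<in> (\<lambda>x::real^1. x $ 1) ` F ` S'" by force
  qed
  ultimately show ?thesis
    by (rule negligible_subset)
qed

text \<open>The change of variables theorem speaks of absolute integrability and signed integrals;
  since \<open>\<phi>\<close> is nonnegative and integrable, both sides can be rewritten as
  nonnegative integrals. The left side is taken over \<open>lebesgue\<close> because the image of a
  Borel set is only obtained as a Lebesgue set. Measurability is asked of the product with the
  indicator, as nothing is known about \<open>h\<close> outside \<open>A\<close>.\<close>

lemma nn_integral_image_inj_on:
  fixes h h' \<phi> :: "real \<Rightarrow> real"
  assumes A [measurable]: "A \<in> sets borel"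
    and der: "\<And>x. x \<in> A \<Longrightarrow> (h has_real_derivative h' x) (at x)"
    and inj: "inj_on h A"
    and meas [measurable]: "(\<lambda>x. indicator A x * \<phi> (h x) * \<bar>h' x\<bar>) \<in> borel_measurable borel"
    and phi: "integrable lborel \<phi>" "\<And>x. \<phi> x \<ge> 0"
  shows "h ` A \<in> sets lebesgue"
    and "(\<integral>\<^sup>+y. ennreal (\<phi> y) * indicator (h ` A) y \<partial>lebesgue)
       = (\<integral>\<^sup>+x. ennreal (\<phi> (h x) * \<bar>h' x\<bar>) * indicator A x \<partial>lborel)"
proof -
  have A': "A \<in> sets lebesgue" by simp
  show im: "h ` A \<in> sets lebesgue"
  proof (rule differentiable_image_in_sets_lebesgue[OF A'])
    show "h differentiable_on A"
      unfolding differentiable_on_def using der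
      by (meson differentiableI differentiable_at_withinI has_field_derivative_imp_has_derivative)
  qed simp
  have phi': "integrable lebesgue \<phi>"
    using phi by (simp add: integrable_completion)
  have si: "\<phi> absolutely_integrable_on h ` A"
    unfolding set_integrable_def
    by (rule integrable_mult_indicator[OF im phi'])
  have eq: "(\<lambda>x. \<bar>h' x\<bar> * \<phi> (h x)) absolutely_integrable_on A \<and>
      integral A (\<lambda>x. \<bar>h' x\<bar> * \<phi> (h x)) = integral (h ` A) \<phi>"
    using has_absolute_integral_change_of_variables_1'[OF A' _ inj, of h' \<phi> "integral (h ` A) \<phi>"]
      si der has_field_derivative_at_within by blast
  have "(\<integral>\<^sup>+y. ennreal (\<phi> y) * indicator (h ` A) y \<partial>lebesgue)
      = (\<integral>\<^sup>+y. ennreal (indicator (h ` A) y *\<^sub>R \<phi> y) \<partial>lebesgue)"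
    by (intro nn_integral_cong) (auto split: split_indicator)
  also have "\<dots> = ennreal (\<integral>y. indicator (h ` A) y *\<^sub>R \<phi> y \<partial>lebesgue)"
    using si phi(2) unfolding set_integrable_def
    by (intro nn_integral_eq_integral) (auto split: split_indicator)
  also have "(\<integral>y. indicator (h ` A) y *\<^sub>R \<phi> y \<partial>lebesgue) = integral (h ` A) \<phi>"
    using set_lebesgue_integral_eq_integral(2)[OF si] by (simp add: set_lebesgue_integral_def)
  also have "\<dots> = integral A (\<lambda>x. \<bar>h' x\<bar> * \<phi> (h x))"
    using eq by simp
  also have "\<dots> = (\<integral>x. indicator A x *\<^sub>R (\<bar>h' x\<bar> * \<phi> (h x)) \<partial>lebesgue)"
    using set_lebesgue_integral_eq_integral(2)[OF eq[THEN conjunct1]]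
    by (simp add: set_lebesgue_integral_def)
  also have "ennreal \<dots> = (\<integral>\<^sup>+x. ennreal (indicator A x *\<^sub>R (\<bar>h' x\<bar> * \<phi> (h x))) \<partial>lebesgue)"
    using eq phi(2) unfolding set_integrable_def
    by (intro nn_integral_eq_integral[symmetric]) (auto split: split_indicator)
  also have "\<dots> = (\<integral>\<^sup>+x. ennreal (indicator A x * \<phi> (h x) * \<bar>h' x\<bar>) \<partial>lebesgue)"
    by (simp add: mult_ac)
  also have "\<dots> = (\<integral>\<^sup>+x. ennreal (indicator A x * \<phi> (h x) * \<bar>h' x\<bar>) \<partial>lborel)"
    by (subst nn_integral_completion) simp_all
  also have "\<dots> = (\<integral>\<^sup>+x. ennreal (\<phi> (h x) * \<bar>h' x\<bar>) * indicator A x \<partial>lborel)"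
    by (intro nn_integral_cong) (auto split: split_indicator)
  finally show "(\<integral>\<^sup>+y. ennreal (\<phi> y) * indicator (h ` A) y \<partial>lebesgue)
       = (\<integral>\<^sup>+x. ennreal (\<phi> (h x) * \<bar>h' x\<bar>) * indicator A x \<partial>lborel)" .
qed

text \<open>A point of nonzero derivative has a rational interval around it on which \<open>h\<close> is
  injective, so the noncritical set splits into countably many pieces of injectivity.\<close>

lemma countable_injective_pieces:
  fixes h h' :: "real \<Rightarrow> real"
  assumes U: "open U" and A: "A \<in> sets borel" "A \<subseteq> U"
    and der: "\<And>x. x \<in> U \<Longrightarrow> (h has_real_derivative h' x) (at x)"
    and cont: "continuous_on U h'"
    and nz: "\<And>x. x \<in> A \<Longrightarrow> h' x \<noteq> 0"
  obtains B :: "nat \<Rightarrow> real set" where "\<And>i. B i \<in> sets borel" "disjoint_family B"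
    "(\<Union>i. B i) = A" "\<And>i. inj_on h (B i)"
proof -
  define R :: "(rat \<times> rat) \<Rightarrow> real set" where
    "R = (\<lambda>(p, q). if inj_on h ({real_of_rat p<..<real_of_rat q} \<inter> U) then {real_of_rat p<..<real_of_rat q} else {})"
  define C where "C = (\<lambda>i::nat. A \<inter> R (from_nat i))"
  have C: "C i \<in> sets borel" for i
    using A by (auto simp: C_def R_def split: prod.splits)
  have injC: "inj_on h (C i)" for i
    using A by (auto simp: C_def R_def split: prod.splits intro: inj_on_subset)
  have cover: "\<exists>i. x \<in> C i" if x: "x \<in> A" for x
  proof -
    have xU: "x \<in> U" using x A by auto
    \<comment> \<open>Multiplying by this sign makes the derivative positive near \<open>x\<close>,
      so that one monotonicity argument covers both an increasing and a decreasing
      \<open>h\<close>.\<close>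
    let ?s = "sgn (h' x)"
    have "continuous (at x) h'"
      using cont U xU by (simp add: continuous_on_eq_continuous_at)
    then have "isCont (\<lambda>y. ?s * h' y) x"
      by (intro continuous_intros) auto
    then have "((\<lambda>y. ?s * h' y) \<longlongrightarrow> ?s * h' x) (nhds x)"
      unfolding isCont_def by (rule tendsto_at_iff_tendsto_nhds[of "\<lambda>y. ?s * h' y" x, THEN iffD1])
    moreover have "0 < ?s * h' x"
      using nz[OF x] by (auto simp: sgn_if)
    ultimately have "\<forall>\<^sub>F y in nhds x. 0 < ?s * h' y"
      by (rule order_tendstoD(1))
    then have "\<forall>\<^sub>F y in nhds x. 0 < ?s * h' y \<and> y \<in> U"
      using eventually_nhds_in_open[OF U xU] by (rule eventually_conj)
    then obtain d where d: "d > 0" "\<And>y. dist y x < d \<Longrightarrow> 0 < ?s * h' y \<and> y \<in> U"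
      unfolding eventually_nhds_metric by blast
    obtain p where p: "x - d < real_of_rat p" "real_of_rat p < x"
      using of_rat_dense[of "x - d" x] d by auto
    obtain q where q: "x < real_of_rat q" "real_of_rat q < x + d"
      using of_rat_dense[of x "x + d"] d by auto
    let ?I = "{real_of_rat p<..<real_of_rat q}"
    have I: "0 < ?s * h' y \<and> y \<in> U" if "y \<in> ?I" for y
      using that p q by (intro d(2)) (auto simp: dist_real_def)
    have "?s * h y < ?s * h z" if "y \<in> ?I" "z \<in> ?I" "y < z" for y z
    proof (rule DERIV_pos_imp_increasing[OF that(3)])
      fix w assume "y \<le> w" "w \<le> z"
      then have w: "w \<in> ?I" using that by auto
      have "((\<lambda>y. ?s * h y) has_real_derivative ?s * h' w) (at w)"
        using I[OF w] by (intro DERIV_cmult der) auto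
      then show "\<exists>d. ((\<lambda>y. ?s * h y) has_real_derivative d) (at w) \<and> 0 < d"
        using I[OF w] by blast
    qed
    then have "inj_on h ?I"
      by (metis (no_types, lifting) inj_onI less_irrefl linorder_neqE_linordered_idom)
    then have "inj_on h (?I \<inter> U)"
      by (auto intro: inj_on_subset)
    then have "x \<in> C (to_nat (p, q))"
      using x p q by (simp add: C_def R_def)
    then show ?thesis by blast
  qed
  show thesis
  proof (rule that[of "disjointed C"])
    show "disjointed C i \<in> sets borel" for i
      using C sets.range_disjointed_sets[of C borel] by auto
    show "disjoint_family (disjointed C)" by (rule disjoint_family_disjointed)
    show "(\<Union>i. disjointed C i) = A"
      unfolding UN_disjointed_eq using cover by (auto simp: C_def)
    show "inj_on h (disjointed C i)" for i
      by (rule inj_on_subset[OF injC disjointed_subset])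
  qed
qed

text \<open>Critical points contribute to neither side: on the left their values form a null set, on
  the right the factor \<bar>h'\<bar> vanishes. The rest of \<open>A\<close> splits into countably
  many disjoint pieces of injectivity. On each of them the number of solutions of
  \<open>h x = y\<close> is the indicator of the image, and both sides are countably
  additive.\<close>

lemma area_formula_real:
  fixes h h' \<phi> :: "real \<Rightarrow> real"
  assumes U: "open U" and A [measurable]: "A \<in> sets borel" and AU: "A \<subseteq> U"
    and der: "\<And>x. x \<in> U \<Longrightarrow> (h has_real_derivative h' x) (at x)"
    and cont: "continuous_on U h'"
    and phi: "integrable lborel \<phi>" "\<And>x. \<phi> x \<ge> 0"
  shows "(\<integral>\<^sup>+y. ennreal (\<phi> y) * emeasure (count_space UNIV) {x \<in> A. h x = y} \<partial>lebesgue)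
       = (\<integral>\<^sup>+x. ennreal (\<phi> (h x) * \<bar>h' x\<bar>) * indicator A x \<partial>lborel)"
proof -
  have [measurable]: "\<phi> \<in> borel_measurable borel" using phi by auto
  have hU: "continuous_on U h"
    using der by (meson DERIV_continuous_on has_field_derivative_at_within)
  have Ub: "U \<in> sets borel" using U by simp
  \<comment> \<open>Extension by zero outside the open set \<open>U\<close> turns continuity on
    \<open>U\<close> into Borel measurability on the line, without changing values at points of
    \<open>A\<close>.\<close>
  have hm: "(\<lambda>x. indicator U x *\<^sub>R h x) \<in> borel_measurable borel"
    using borel_measurable_continuous_on_indicator[OF Ub hU] by simp
  have h'm: "(\<lambda>x. indicator U x *\<^sub>R h' x) \<in> borel_measurable borel"
    using borel_measurable_continuous_on_indicator[OF Ub cont] by simp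
  define A' where "A' = {x \<in> A. h' x \<noteq> 0}"
  have "A' = {x \<in> space borel. x \<in> A \<and> indicator U x *\<^sub>R h' x \<noteq> 0}"
    using AU by (auto simp: A'_def)
  also have "\<dots> \<in> sets borel" using h'm by measurable
  finally have A' [measurable]: "A' \<in> sets borel" .
  have A'U: "A' \<subseteq> U" using AU by (auto simp: A'_def)
  have A'nz: "h' x \<noteq> 0" if "x \<in> A'" for x using that by (simp add: A'_def)
  obtain B :: "nat \<Rightarrow> real set" where B: "\<And>i. B i \<in> sets borel" "disjoint_family B"
    "(\<Union>i. B i) = A'" "\<And>i. inj_on h (B i)"
    by (rule countable_injective_pieces[OF U A' A'U der cont A'nz]) (assumption+, rule that)
  have BU: "B i \<subseteq> A'" for i using B(3) by auto
  have mB: "(\<lambda>x. indicator (B i) x * \<phi> (h x) * \<bar>h' x\<bar>) \<in> borel_measurable borel" for i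
  proof -
    have "(\<lambda>x. indicator (B i) x * \<phi> (indicator U x *\<^sub>R h x) * \<bar>indicator U x *\<^sub>R h' x\<bar>) \<in> borel_measurable borel"
      using hm h'm B(1)[of i] by measurable
    moreover have "(\<lambda>x. indicator (B i) x * \<phi> (indicator U x *\<^sub>R h x) * \<bar>indicator U x *\<^sub>R h' x\<bar>)
       = (\<lambda>x. indicator (B i) x * \<phi> (h x) * \<bar>h' x\<bar>)"
      using BU[of i] AU by (auto simp: fun_eq_iff A'_def split: split_indicator)
    ultimately show ?thesis by simp
  qed
  have derB: "(h has_real_derivative h' x) (at x)" if "x \<in> B i" for x i
    using that BU[of i] AU by (intro der) (auto simp: A'_def)
  note cv = nn_integral_image_inj_on[OF B(1) derB B(4) mB phi]
  have "negligible (h ` (A - A'))"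
    using AU der by (intro negligible_critical_values) (force simp: A'_def)
  then have "AE y in lebesgue. y \<notin> h ` (A - A')"
    by (simp add: negligible_iff_null_sets AE_not_in)
  then have ae: "AE y in lebesgue. ennreal (\<phi> y) * emeasure (count_space UNIV) {x \<in> A. h x = y}
     = (\<Sum>i. ennreal (\<phi> y) * indicator (h ` B i) y)"
  proof (rule AE_mp, intro AE_I2 impI)
    fix y assume y: "y \<notin> h ` (A - A')"
    then have "{x \<in> A. h x = y} = (\<Union>i. {x \<in> B i. h x = y})"
      using B(3) by (auto simp: A'_def)
    moreover have "emeasure (count_space UNIV) (\<Union>i. {x \<in> B i. h x = y})
       = (\<Sum>i. emeasure (count_space UNIV) {x \<in> B i. h x = y})"
      using B(2) by (intro suminf_emeasure[symmetric]) (auto simp: disjoint_family_on_def)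
    moreover have "emeasure (count_space UNIV) {x \<in> B i. h x = y} = indicator (h ` B i) y" for i
    proof (cases "y \<in> h ` B i")
      case True
      then obtain x where "x \<in> B i" "y = h x" by auto
      then have "{x \<in> B i. h x = y} = {x}"
        using B(4)[of i] by (auto simp: inj_on_def)
      then show ?thesis using True by simp
    next
      case False
      then have E: "{x \<in> B i. h x = y} = {}" by auto
      show ?thesis unfolding E using False by simp
    qed
    ultimately show "ennreal (\<phi> y) * emeasure (count_space UNIV) {x \<in> A. h x = y}
     = (\<Sum>i. ennreal (\<phi> y) * indicator (h ` B i) y)" by simp
  qed
  have [measurable]: "h ` B i \<in> sets lebesgue" for i by (rule cv(1))
  have [measurable]: "\<phi> \<in> borel_measurable lebesgue"
    by (rule measurable_completion) simp
  have "(\<integral>\<^sup>+y. ennreal (\<phi> y) * emeasure (count_space UNIV) {x \<in> A. h x = y} \<partial>lebesgue)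
      = (\<integral>\<^sup>+y. (\<Sum>i. ennreal (\<phi> y) * indicator (h ` B i) y) \<partial>lebesgue)"
    by (rule nn_integral_cong_AE[OF ae])
  also have "\<dots> = (\<Sum>i. \<integral>\<^sup>+y. ennreal (\<phi> y) * indicator (h ` B i) y \<partial>lebesgue)"
    by (rule nn_integral_suminf) measurable
  also have "\<dots> = (\<Sum>i. \<integral>\<^sup>+x. ennreal (\<phi> (h x) * \<bar>h' x\<bar>) * indicator (B i) x \<partial>lborel)"
    by (simp only: cv(2))
  also have "\<dots> = (\<integral>\<^sup>+x. (\<Sum>i. ennreal (\<phi> (h x) * \<bar>h' x\<bar>) * indicator (B i) x) \<partial>lborel)"
  proof (rule nn_integral_suminf[symmetric])
    fix i
    have "(\<lambda>x. ennreal (indicator (B i) x * \<phi> (h x) * \<bar>h' x\<bar>)) \<in> borel_measurable lborel"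
      using mB[of i] by simp
    moreover have "(\<lambda>x. ennreal (indicator (B i) x * \<phi> (h x) * \<bar>h' x\<bar>))
       = (\<lambda>x. ennreal (\<phi> (h x) * \<bar>h' x\<bar>) * indicator (B i) x)"
      by (auto simp: fun_eq_iff split: split_indicator)
    ultimately show "(\<lambda>x. ennreal (\<phi> (h x) * \<bar>h' x\<bar>) * indicator (B i) x) \<in> borel_measurable lborel"
      by simp
  qed
  also have "\<dots> = (\<integral>\<^sup>+x. ennreal (\<phi> (h x) * \<bar>h' x\<bar>) * indicator A x \<partial>lborel)"
  proof (rule nn_integral_cong)
    fix x :: real
    have "(\<Sum>i. ennreal (\<phi> (h x) * \<bar>h' x\<bar>) * indicator (B i) x)
       = ennreal (\<phi> (h x) * \<bar>h' x\<bar>) * indicator A' x"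
      using suminf_indicator[OF B(2), of x] B(3) by simp
    also have "\<dots> = ennreal (\<phi> (h x) * \<bar>h' x\<bar>) * indicator A x"
      by (auto simp: A'_def split: split_indicator)
    finally show "(\<Sum>i. ennreal (\<phi> (h x) * \<bar>h' x\<bar>) * indicator (B i) x)
      = ennreal (\<phi> (h x) * \<bar>h' x\<bar>) * indicator A x" .
  qed
  finally show ?thesis .
qed

section \<open>Gaussian integrals\<close>

definition std_gauss :: "real measure" where
  "std_gauss = density lborel std_normal_density"

lemma sets_std_gauss [measurable_cong, simp]: "sets std_gauss = sets borel"
  by (simp add: std_gauss_def)

lemma space_std_gauss [simp]: "space std_gauss = UNIV"
  by (simp add: std_gauss_def)

lemma prob_space_std_gauss: "prob_space std_gauss"
  unfolding std_gauss_def by (rule prob_space_normal_density) simp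

lemma nn_integral_std_gauss:
  assumes "f \<in> borel_measurable borel"
  shows "(\<integral>\<^sup>+x. f x \<partial>std_gauss) = (\<integral>\<^sup>+x. ennreal (std_normal_density x) * f x \<partial>lborel)"
  unfolding std_gauss_def using assms by (subst nn_integral_density) simp_all

interpretation std_gauss: prob_space std_gauss
  by (rule prob_space_std_gauss)

interpretation std_gauss_pair: pair_sigma_finite std_gauss std_gauss
  by (intro pair_sigma_finite.intro std_gauss.sigma_finite_measure_axioms)

interpretation std_gauss_product: product_sigma_finite "\<lambda>_. std_gauss"
  by (intro product_sigma_finite.intro std_gauss.sigma_finite_measure_axioms)

section \<open>Rotation invariance of the standard Gaussian in the plane\<close>

lemma nn_integral_std_gauss_swap:
  fixes F :: "real \<times> real \<Rightarrow> ennreal"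
  assumes [measurable]: "F \<in> borel_measurable (borel \<Otimes>\<^sub>M borel)"
  shows "(\<integral>\<^sup>+t. (\<integral>\<^sup>+s. F (s, t) \<partial>std_gauss) \<partial>std_gauss) = (\<integral>\<^sup>+s. (\<integral>\<^sup>+t. F (s, t) \<partial>std_gauss) \<partial>std_gauss)"
proof -
  have "F \<in> borel_measurable (std_gauss \<Otimes>\<^sub>M std_gauss)" by measurable
  from std_gauss_pair.Fubini[OF this] show ?thesis by simp
qed

lemma nn_integral_std_gauss_reflect:
  assumes [measurable]: "f \<in> borel_measurable borel" and "\<bar>d\<bar> = 1"
  shows "(\<integral>\<^sup>+x. f (d * x) \<partial>std_gauss) = (\<integral>\<^sup>+x. f x \<partial>std_gauss)"
proof -
  have d: "d = 1 \<or> d = -1" using assms(2) by auto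
  then have e: "std_normal_density (d * x) = std_normal_density x" for x
    by (auto simp: std_normal_density_def)
  have "(\<integral>\<^sup>+x. f x \<partial>std_gauss) = (\<integral>\<^sup>+x. ennreal (std_normal_density x) * f x \<partial>lborel)"
    by (simp add: nn_integral_std_gauss)
  also have "\<dots> = ennreal \<bar>d\<bar> * (\<integral>\<^sup>+x. ennreal (std_normal_density (0 + d * x)) * f (0 + d * x) \<partial>lborel)"
    using d by (intro nn_integral_real_affine) auto
  also have "\<dots> = (\<integral>\<^sup>+x. f (d * x) \<partial>std_gauss)"
    using assms(2) by (simp add: nn_integral_std_gauss e)
  finally show ?thesis by simp
qed

text \<open>The rotation is factored into two one-dimensional affine substitutions, p = cs + dt for
  fixed t and then t = dp + cq for fixed p, with Tonelli in between. Each substitution brings a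
  factor \<bar>c\<bar>, one on either side of the identity, and these cancel. Division by c excludes
  c = 0; there the rotation is a quarter turn, composed of an exchange of variables and
  reflections.\<close>

lemma nn_integral_std_gauss_rotation:
  fixes F :: "real \<times> real \<Rightarrow> ennreal"
  assumes F [measurable]: "F \<in> borel_measurable (borel \<Otimes>\<^sub>M borel)" and cd: "c\<^sup>2 + d\<^sup>2 = 1"
  shows "(\<integral>\<^sup>+t. (\<integral>\<^sup>+s. F (c * s + d * t, c * t - d * s) \<partial>std_gauss) \<partial>std_gauss)
       = (\<integral>\<^sup>+q. (\<integral>\<^sup>+p. F (p, q) \<partial>std_gauss) \<partial>std_gauss)"
proof (cases "c = 0")
  case True
  then have d: "\<bar>d\<bar> = 1" "\<bar>- d\<bar> = 1" using cd by (auto simp: power2_eq_1_iff)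
  have "(\<integral>\<^sup>+t. (\<integral>\<^sup>+s. F (c * s + d * t, c * t - d * s) \<partial>std_gauss) \<partial>std_gauss)
      = (\<integral>\<^sup>+t. (\<integral>\<^sup>+s. F (d * t, (- d) * s) \<partial>std_gauss) \<partial>std_gauss)"
    using True by simp
  also have "\<dots> = (\<integral>\<^sup>+t. (\<integral>\<^sup>+s. F (d * t, s) \<partial>std_gauss) \<partial>std_gauss)"
    by (intro nn_integral_cong nn_integral_std_gauss_reflect[OF _ d(2)]) measurable
  also have "\<dots> = (\<integral>\<^sup>+t. (\<integral>\<^sup>+s. F (t, s) \<partial>std_gauss) \<partial>std_gauss)"
    by (rule nn_integral_std_gauss_reflect[OF _ d(1), of "\<lambda>t. \<integral>\<^sup>+s. F (t, s) \<partial>std_gauss"]) measurable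
  also have "\<dots> = (\<integral>\<^sup>+q. (\<integral>\<^sup>+p. F (p, q) \<partial>std_gauss) \<partial>std_gauss)"
    by (rule nn_integral_std_gauss_swap[symmetric]) measurable
  finally show ?thesis .
next
  case False
  define w where "w = (\<lambda>s t. ennreal (std_normal_density s) * ennreal (std_normal_density t))"
  have [measurable]: "(\<lambda>x. w (f x) (g x)) \<in> borel_measurable M"
    if [measurable]: "f \<in> borel_measurable M" "g \<in> borel_measurable M" for f g and M :: "'z measure"
    unfolding w_def by measurable
  \<comment> \<open>The integrand in the mixed coordinates (p, t), one old and one new: here s = (p
    - dt)/c and q = (t - dp)/c. The Gaussian weight \<open>w\<close> keeps its value because the
    rotation preserves the sum of squares.\<close>
  define G where "G = (\<lambda>p t. w ((p - d * t) / c) t * F (p, (t - d * p) / c))"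
  have [measurable]: "case_prod G \<in> borel_measurable (borel \<Otimes>\<^sub>M borel)"
    unfolding G_def by measurable
  have dd: "d * d = 1 - c * c" using cd by (simp add: power2_eq_square)
  have G1: "G (d * t + c * s) t = w s t * F (c * s + d * t, c * t - d * s)" for s t
  proof -
    have "t - d * (d * t + c * s) = (1 - d * d) * t - c * d * s" by algebra
    also have "\<dots> = c * (c * t - d * s)" unfolding dd by algebra
    finally have "(t - d * (d * t + c * s)) / c = c * t - d * s" using False by simp
    then show ?thesis using False by (simp add: G_def add.commute)
  qed
  have G2: "G p (d * p + c * q) = w p q * F (p, q)" for p q
  proof -
    have "p - d * (d * p + c * q) = (1 - d * d) * p - c * d * q" by algebra
    also have "\<dots> = c * (c * p - d * q)" unfolding dd by algebra
    finally have "(p - d * (d * p + c * q)) / c = c * p - d * q" using False by simp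
    moreover have "(c * p - d * q)\<^sup>2 + (d * p + c * q)\<^sup>2 = (c\<^sup>2 + d\<^sup>2) * (p\<^sup>2 + q\<^sup>2)"
      by (simp add: power2_eq_square algebra_simps)
    then have "w (c * p - d * q) (d * p + c * q) = w p q"
      unfolding w_def std_normal_density_def
      by (simp add: cd flip: ennreal_mult exp_add add_divide_distrib)
    ultimately show ?thesis using False by (simp add: G_def)
  qed
  have "ennreal \<bar>c\<bar> * (\<integral>\<^sup>+t. (\<integral>\<^sup>+s. F (c * s + d * t, c * t - d * s) \<partial>std_gauss) \<partial>std_gauss)
     = ennreal \<bar>c\<bar> * (\<integral>\<^sup>+t. (\<integral>\<^sup>+s. w s t * F (c * s + d * t, c * t - d * s) \<partial>lborel) \<partial>lborel)"
    by (simp add: nn_integral_std_gauss w_def mult_ac flip: nn_integral_cmult)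
  also have "\<dots> = (\<integral>\<^sup>+t. ennreal \<bar>c\<bar> * (\<integral>\<^sup>+s. G (d * t + c * s) t \<partial>lborel) \<partial>lborel)"
    unfolding G1 by (subst nn_integral_cmult) auto
  also have "\<dots> = (\<integral>\<^sup>+t. (\<integral>\<^sup>+p. G p t \<partial>lborel) \<partial>lborel)"
    using False by (intro nn_integral_cong nn_integral_real_affine[symmetric]) measurable
  also have "\<dots> = (\<integral>\<^sup>+p. (\<integral>\<^sup>+t. G p t \<partial>lborel) \<partial>lborel)"
    by (rule lborel_pair.Fubini') measurable
  also have "\<dots> = (\<integral>\<^sup>+p. ennreal \<bar>c\<bar> * (\<integral>\<^sup>+q. G p (d * p + c * q) \<partial>lborel) \<partial>lborel)"
    using False by (intro nn_integral_cong nn_integral_real_affine) measurable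
  also have "\<dots> = ennreal \<bar>c\<bar> * (\<integral>\<^sup>+p. (\<integral>\<^sup>+q. w p q * F (p, q) \<partial>lborel) \<partial>lborel)"
    unfolding G2 by (subst nn_integral_cmult) auto
  also have "(\<integral>\<^sup>+p. (\<integral>\<^sup>+q. w p q * F (p, q) \<partial>lborel) \<partial>lborel) = (\<integral>\<^sup>+p. (\<integral>\<^sup>+q. F (p, q) \<partial>std_gauss) \<partial>std_gauss)"
    by (simp add: nn_integral_std_gauss w_def mult_ac flip: nn_integral_cmult)
  also have "\<dots> = (\<integral>\<^sup>+q. (\<integral>\<^sup>+p. F (p, q) \<partial>std_gauss) \<partial>std_gauss)"
    by (rule nn_integral_std_gauss_swap[symmetric]) measurable
  finally show ?thesis
    using False by (simp add: ennreal_mult_cancel_left)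
qed

lemma polar_real:
  obtains c d :: real where "c\<^sup>2 + d\<^sup>2 = 1" "a = sqrt (a\<^sup>2 + b\<^sup>2) * c" "b = sqrt (a\<^sup>2 + b\<^sup>2) * d"
proof (cases "a\<^sup>2 + b\<^sup>2 = 0")
  case True
  then show thesis by (intro that[of 1 0]) auto
next
  case False
  then have "(sqrt (a\<^sup>2 + b\<^sup>2))\<^sup>2 = a\<^sup>2 + b\<^sup>2" "sqrt (a\<^sup>2 + b\<^sup>2) \<noteq> 0" by auto
  with False show thesis
    by (intro that[of "a / sqrt (a\<^sup>2 + b\<^sup>2)" "b / sqrt (a\<^sup>2 + b\<^sup>2)"])
       (simp_all add: power_divide flip: add_divide_distrib)
qed

text \<open>Rotate so that the first axis points along (a, b): the integrand then depends on the
  first coordinate only, and the second integrates to 1.\<close>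

lemma nn_integral_std_gauss_combine:
  assumes [measurable]: "H \<in> borel_measurable borel"
  shows "(\<integral>\<^sup>+t. (\<integral>\<^sup>+s. H (a * s + b * t) \<partial>std_gauss) \<partial>std_gauss)
       = (\<integral>\<^sup>+p. H (sqrt (a\<^sup>2 + b\<^sup>2) * p) \<partial>std_gauss)"
proof -
  define \<rho> where "\<rho> = sqrt (a\<^sup>2 + b\<^sup>2)"
  obtain c d where cd: "c\<^sup>2 + d\<^sup>2 = 1" and a: "a = \<rho> * c" and b: "b = \<rho> * d"
    unfolding \<rho>_def by (rule polar_real)
  have "a * s + b * t = \<rho> * (c * s + d * t)" for s t
    by (simp add: a b algebra_simps)
  then have "(\<integral>\<^sup>+t. (\<integral>\<^sup>+s. H (a * s + b * t) \<partial>std_gauss) \<partial>std_gauss)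
     = (\<integral>\<^sup>+t. (\<integral>\<^sup>+s. (\<lambda>(p, q). H (\<rho> * p)) (c * s + d * t, c * t - d * s) \<partial>std_gauss) \<partial>std_gauss)"
    by simp
  also have "\<dots> = (\<integral>\<^sup>+q. (\<integral>\<^sup>+p. (\<lambda>(p, q). H (\<rho> * p)) (p, q) \<partial>std_gauss) \<partial>std_gauss)"
    by (intro nn_integral_std_gauss_rotation cd) measurable
  also have "\<dots> = (\<integral>\<^sup>+p. H (\<rho> * p) \<partial>std_gauss)"
    by (simp add: std_gauss.emeasure_space_1[simplified])
  finally show ?thesis by (simp add: \<rho>_def)
qed

text \<open>This is the Cholesky form of the covariance of two linear forms in independent standard
  normals. The coefficients are described by equations, because the explicit quotient for \<beta>
  breaks down when \<alpha> = 0. In the induction, the new variable is rotated together with s so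
  that the first form depends on a single variable; the remaining two independent terms of the
  second form are then merged into one.\<close>

lemma gaussian_pair_representation:
  fixes u v :: "'i \<Rightarrow> real"
  assumes "finite J"
  shows "\<exists>\<alpha> \<beta> \<gamma>. \<alpha>\<^sup>2 = (\<Sum>j\<in>J. (u j)\<^sup>2) \<and> \<alpha> * \<beta> = (\<Sum>j\<in>J. u j * v j) \<and>
      \<beta>\<^sup>2 + \<gamma>\<^sup>2 = (\<Sum>j\<in>J. (v j)\<^sup>2) \<and>
      (\<forall>F :: real \<times> real \<Rightarrow> ennreal. F \<in> borel_measurable (borel \<Otimes>\<^sub>M borel) \<longrightarrow>
        (\<integral>\<^sup>+w. F (\<Sum>j\<in>J. u j * w j, \<Sum>j\<in>J. v j * w j) \<partial>Pi\<^sub>M J (\<lambda>_. std_gauss)) =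
        (\<integral>\<^sup>+t. (\<integral>\<^sup>+s. F (\<alpha> * s, \<beta> * s + \<gamma> * t) \<partial>std_gauss) \<partial>std_gauss))"
  using assms
proof (induction J rule: finite_induct)
  case empty
  show ?case
    by (rule exI[of _ 0], rule exI[of _ 0], rule exI[of _ 0])
       (auto simp: PiM_empty nn_integral_count_space_finite std_gauss.emeasure_space_1[simplified])
next
  case (insert i J)
  from insert.IH obtain \<alpha> \<beta> \<gamma> where
    su: "\<alpha>\<^sup>2 = (\<Sum>j\<in>J. (u j)\<^sup>2)" and suv: "\<alpha> * \<beta> = (\<Sum>j\<in>J. u j * v j)" and
    sv: "\<beta>\<^sup>2 + \<gamma>\<^sup>2 = (\<Sum>j\<in>J. (v j)\<^sup>2)" and
    IH: "\<And>F :: real \<times> real \<Rightarrow> ennreal. F \<in> borel_measurable (borel \<Otimes>\<^sub>M borel) \<Longrightarrow>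
        (\<integral>\<^sup>+w. F (\<Sum>j\<in>J. u j * w j, \<Sum>j\<in>J. v j * w j) \<partial>Pi\<^sub>M J (\<lambda>_. std_gauss)) =
        (\<integral>\<^sup>+t. (\<integral>\<^sup>+s. F (\<alpha> * s, \<beta> * s + \<gamma> * t) \<partial>std_gauss) \<partial>std_gauss)"
    by blast
  define \<rho> where "\<rho> = sqrt (\<alpha>\<^sup>2 + (u i)\<^sup>2)"
  obtain c d where cd: "c\<^sup>2 + d\<^sup>2 = 1" and a: "\<alpha> = \<rho> * c" and b: "u i = \<rho> * d"
    unfolding \<rho>_def by (rule polar_real)
  \<comment> \<open>In the plane of s and the new variable, \<beta>' and \<delta> are the components
    of the vector (\<beta>, v i) along the unit vector (c, d) and along its orthogonal (-d,
    c).\<close>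
  define \<delta> where "\<delta> = v i * c - \<beta> * d"
  define \<beta>' where "\<beta>' = \<beta> * c + v i * d"
  define \<gamma>' where "\<gamma>' = sqrt (\<delta>\<^sup>2 + \<gamma>\<^sup>2)"
  have "\<beta>'\<^sup>2 + \<delta>\<^sup>2 = (c\<^sup>2 + d\<^sup>2) * (\<beta>\<^sup>2 + (v i)\<^sup>2)"
    by (simp add: \<beta>'_def \<delta>_def power2_eq_square algebra_simps)
  then have "\<beta>'\<^sup>2 + \<gamma>'\<^sup>2 = (\<Sum>j\<in>insert i J. (v j)\<^sup>2)"
    using insert.hyps cd by (simp add: \<gamma>'_def sv[symmetric])
  moreover have "\<rho>\<^sup>2 = (\<Sum>j\<in>insert i J. (u j)\<^sup>2)"
    using insert.hyps by (simp add: \<rho>_def su[symmetric])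
  moreover have "\<rho> * \<beta>' = (\<Sum>j\<in>insert i J. u j * v j)"
    using insert.hyps by (simp add: \<beta>'_def suv[symmetric] a b algebra_simps)
  moreover have "(\<integral>\<^sup>+w. F (\<Sum>j\<in>insert i J. u j * w j, \<Sum>j\<in>insert i J. v j * w j) \<partial>Pi\<^sub>M (insert i J) (\<lambda>_. std_gauss)) =
        (\<integral>\<^sup>+t. (\<integral>\<^sup>+s. F (\<rho> * s, \<beta>' * s + \<gamma>' * t) \<partial>std_gauss) \<partial>std_gauss)"
    if F [measurable]: "F \<in> borel_measurable (borel \<Otimes>\<^sub>M borel)" for F :: "real \<times> real \<Rightarrow> ennreal"
  proof -
    have upd: "(\<Sum>j\<in>J. g j * (w(i := y)) j) = (\<Sum>j\<in>J. g j * w j)" for g w and y :: real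
      using insert.hyps by (intro sum.cong) auto
    have "(\<integral>\<^sup>+w. F (\<Sum>j\<in>insert i J. u j * w j, \<Sum>j\<in>insert i J. v j * w j) \<partial>Pi\<^sub>M (insert i J) (\<lambda>_. std_gauss))
      = (\<integral>\<^sup>+w. (\<integral>\<^sup>+y. F (\<Sum>j\<in>insert i J. u j * (w(i := y)) j, \<Sum>j\<in>insert i J. v j * (w(i := y)) j) \<partial>std_gauss) \<partial>Pi\<^sub>M J (\<lambda>_. std_gauss))"
      using insert.hyps by (intro std_gauss_product.product_nn_integral_insert) measurable
    also have "\<dots> = (\<integral>\<^sup>+w. (\<lambda>(x, z). \<integral>\<^sup>+y. F (x + u i * y, z + v i * y) \<partial>std_gauss)
        (\<Sum>j\<in>J. u j * w j, \<Sum>j\<in>J. v j * w j) \<partial>Pi\<^sub>M J (\<lambda>_. std_gauss))"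
      using insert.hyps by (simp add: upd add.commute del: fun_upd_apply) (simp add: add.commute)
    also have "\<dots> = (\<integral>\<^sup>+t. (\<integral>\<^sup>+s. (\<integral>\<^sup>+y. F (\<alpha> * s + u i * y, \<beta> * s + \<gamma> * t + v i * y) \<partial>std_gauss) \<partial>std_gauss) \<partial>std_gauss)"
      by (subst IH) simp_all
    also have "\<dots> = (\<integral>\<^sup>+t. (\<integral>\<^sup>+y. (\<integral>\<^sup>+s. F (\<alpha> * s + u i * y, \<beta> * s + \<gamma> * t + v i * y) \<partial>std_gauss) \<partial>std_gauss) \<partial>std_gauss)"
    proof (rule nn_integral_cong)
      fix t
      show "(\<integral>\<^sup>+s. (\<integral>\<^sup>+y. F (\<alpha> * s + u i * y, \<beta> * s + \<gamma> * t + v i * y) \<partial>std_gauss) \<partial>std_gauss) =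
        (\<integral>\<^sup>+y. (\<integral>\<^sup>+s. F (\<alpha> * s + u i * y, \<beta> * s + \<gamma> * t + v i * y) \<partial>std_gauss) \<partial>std_gauss)"
        using nn_integral_std_gauss_swap[of "\<lambda>(s, y). F (\<alpha> * s + u i * y, \<beta> * s + \<gamma> * t + v i * y)"]
        by simp
    qed
    also have "\<dots> = (\<integral>\<^sup>+t. (\<integral>\<^sup>+q. (\<integral>\<^sup>+p. F (\<rho> * p, \<beta>' * p + \<delta> * q + \<gamma> * t) \<partial>std_gauss) \<partial>std_gauss) \<partial>std_gauss)"
    proof (rule nn_integral_cong)
      fix t
      define K where "K = (\<lambda>(p, q). F (\<rho> * p, \<beta>' * p + \<delta> * q + \<gamma> * t))"
      have [measurable]: "K \<in> borel_measurable (borel \<Otimes>\<^sub>M borel)" unfolding K_def by measurable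
      have "F (\<alpha> * s + u i * y, \<beta> * s + \<gamma> * t + v i * y) = K (c * s + d * y, c * y - d * s)" for s y
      proof -
        have "\<beta>' * (c * s + d * y) + \<delta> * (c * y - d * s) = (c\<^sup>2 + d\<^sup>2) * (\<beta> * s + v i * y)"
          by (simp add: \<beta>'_def \<delta>_def power2_eq_square algebra_simps)
        then have "\<beta>' * (c * s + d * y) + \<delta> * (c * y - d * s) = \<beta> * s + v i * y"
          using cd by simp
        moreover have "\<rho> * (c * s + d * y) = \<alpha> * s + u i * y"
          by (simp add: a b algebra_simps)
        ultimately show ?thesis by (simp add: K_def algebra_simps)
      qed
      then have "(\<integral>\<^sup>+y. (\<integral>\<^sup>+s. F (\<alpha> * s + u i * y, \<beta> * s + \<gamma> * t + v i * y) \<partial>std_gauss) \<partial>std_gauss)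
        = (\<integral>\<^sup>+y. (\<integral>\<^sup>+s. K (c * s + d * y, c * y - d * s) \<partial>std_gauss) \<partial>std_gauss)" by simp
      also have "\<dots> = (\<integral>\<^sup>+q. (\<integral>\<^sup>+p. K (p, q) \<partial>std_gauss) \<partial>std_gauss)"
        by (intro nn_integral_std_gauss_rotation cd) measurable
      finally show "(\<integral>\<^sup>+y. (\<integral>\<^sup>+s. F (\<alpha> * s + u i * y, \<beta> * s + \<gamma> * t + v i * y) \<partial>std_gauss) \<partial>std_gauss)
        = (\<integral>\<^sup>+q. (\<integral>\<^sup>+p. F (\<rho> * p, \<beta>' * p + \<delta> * q + \<gamma> * t) \<partial>std_gauss) \<partial>std_gauss)"
        by (simp add: K_def)
    qed
    \<comment> \<open>The variables q and t now enter only through \<delta>q + \<gamma>t, which has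
      the law of \<gamma>' times one standard normal variable.\<close>
    also have "\<dots> = (\<integral>\<^sup>+t. (\<integral>\<^sup>+q. (\<lambda>z. \<integral>\<^sup>+p. F (\<rho> * p, \<beta>' * p + z) \<partial>std_gauss) (\<delta> * q + \<gamma> * t) \<partial>std_gauss) \<partial>std_gauss)"
      by (simp add: add.assoc)
    also have "\<dots> = (\<integral>\<^sup>+q. (\<lambda>z. \<integral>\<^sup>+p. F (\<rho> * p, \<beta>' * p + z) \<partial>std_gauss) (\<gamma>' * q) \<partial>std_gauss)"
      unfolding \<gamma>'_def by (rule nn_integral_std_gauss_combine) measurable
    finally show ?thesis by simp
  qed
  ultimately show ?case by blast
qed

text \<open>The factor \<open>std_normal_density (\<alpha> * s)\<close> merges with the weight of s
  into a Gaussian of variance 1/(1 + \<alpha>^2). Rescaling s by \<kappa> makes it standard again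
  and replaces \<beta> by \<beta>/\<kappa>; what remains is the mean modulus of a centred Gaussian
  of standard deviation \<tau>.\<close>

lemma nn_integral_std_gauss_density_abs:
  "(\<integral>\<^sup>+t. (\<integral>\<^sup>+s. ennreal (std_normal_density (\<alpha> * s) * \<bar>\<beta> * s + \<gamma> * t\<bar>) \<partial>std_gauss) \<partial>std_gauss)
    = ennreal (sqrt ((\<beta>\<^sup>2 + \<gamma>\<^sup>2) * (1 + \<alpha>\<^sup>2) - (\<alpha> * \<beta>)\<^sup>2) / (pi * (1 + \<alpha>\<^sup>2)))"
proof -
  define \<kappa> where "\<kappa> = sqrt (1 + \<alpha>\<^sup>2)"
  have k: "\<kappa> > 0" "\<kappa>\<^sup>2 = 1 + \<alpha>\<^sup>2"
    by (auto simp: \<kappa>_def add_pos_nonneg)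
  define \<tau> where "\<tau> = sqrt ((\<beta> / \<kappa>)\<^sup>2 + \<gamma>\<^sup>2)"
  have inner: "(\<integral>\<^sup>+s. ennreal (std_normal_density (\<alpha> * s) * \<bar>\<beta> * s + \<gamma> * t\<bar>) \<partial>std_gauss)
    = (\<integral>\<^sup>+s. ennreal (std_normal_density 0 / \<kappa> * \<bar>\<beta> / \<kappa> * s + \<gamma> * t\<bar>) \<partial>std_gauss)" for t
  proof -
    have e: "std_normal_density s * std_normal_density (\<alpha> * s) = std_normal_density 0 * std_normal_density (\<kappa> * s)" for s
    proof -
      have "- s\<^sup>2 / 2 + - (\<alpha> * s)\<^sup>2 / 2 = - (\<kappa> * s)\<^sup>2 / 2"
        by (simp add: power_mult_distrib k field_simps)
      then show ?thesis
        unfolding std_normal_density_def by (simp add: mult_ac flip: exp_add)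
    qed
    have "(\<integral>\<^sup>+s. ennreal (std_normal_density (\<alpha> * s) * \<bar>\<beta> * s + \<gamma> * t\<bar>) \<partial>std_gauss)
      = (\<integral>\<^sup>+s. ennreal (std_normal_density 0 * std_normal_density (\<kappa> * s) * \<bar>\<beta> * s + \<gamma> * t\<bar>) \<partial>lborel)"
      by (simp add: nn_integral_std_gauss e[symmetric] mult.assoc flip: ennreal_mult)
    also have "\<dots> = ennreal \<bar>1 / \<kappa>\<bar> * (\<integral>\<^sup>+s. ennreal (std_normal_density 0 * std_normal_density (\<kappa> * (0 + 1 / \<kappa> * s)) * \<bar>\<beta> * (0 + 1 / \<kappa> * s) + \<gamma> * t\<bar>) \<partial>lborel)"
      using k by (subst nn_integral_real_affine[where t = 0 and c = "1 / \<kappa>"]) simp_all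
    also have "\<dots> = (\<integral>\<^sup>+s. ennreal \<bar>1 / \<kappa>\<bar> * ennreal (std_normal_density 0 * std_normal_density (\<kappa> * (0 + 1 / \<kappa> * s)) * \<bar>\<beta> * (0 + 1 / \<kappa> * s) + \<gamma> * t\<bar>) \<partial>lborel)"
      by (rule nn_integral_cmult[symmetric]) simp
    also have "\<dots> = (\<integral>\<^sup>+s. ennreal (std_normal_density s) * ennreal (std_normal_density 0 / \<kappa> * \<bar>\<beta> / \<kappa> * s + \<gamma> * t\<bar>) \<partial>lborel)"
      using k by (intro nn_integral_cong) (simp add: mult_ac flip: ennreal_mult)
    also have "\<dots> = (\<integral>\<^sup>+s. ennreal (std_normal_density 0 / \<kappa> * \<bar>\<beta> / \<kappa> * s + \<gamma> * t\<bar>) \<partial>std_gauss)"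
      by (simp add: nn_integral_std_gauss)
    finally show ?thesis .
  qed
  have "(\<integral>\<^sup>+t. (\<integral>\<^sup>+s. ennreal (std_normal_density (\<alpha> * s) * \<bar>\<beta> * s + \<gamma> * t\<bar>) \<partial>std_gauss) \<partial>std_gauss)
      = (\<integral>\<^sup>+t. (\<integral>\<^sup>+s. (\<lambda>x. ennreal (std_normal_density 0 / \<kappa> * \<bar>x\<bar>)) (\<beta> / \<kappa> * s + \<gamma> * t) \<partial>std_gauss) \<partial>std_gauss)"
    by (simp add: inner)
  also have "\<dots> = (\<integral>\<^sup>+p. (\<lambda>x. ennreal (std_normal_density 0 / \<kappa> * \<bar>x\<bar>)) (\<tau> * p) \<partial>std_gauss)"
    unfolding \<tau>_def by (rule nn_integral_std_gauss_combine) measurable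
  also have "\<dots> = (\<integral>\<^sup>+p. ennreal (std_normal_density 0 / \<kappa> * \<tau>) * ennreal (std_normal_density p * \<bar>p\<bar> ^ 1) \<partial>lborel)"
    using k by (simp add: nn_integral_std_gauss) (intro nn_integral_cong, simp add: \<tau>_def abs_mult mult_ac flip: ennreal_mult)
  also have "\<dots> = ennreal (std_normal_density 0 / \<kappa> * \<tau>) * ennreal (sqrt (2 / pi))"
  proof (subst nn_integral_cmult)
    have "has_bochner_integral lborel (\<lambda>x. std_normal_density x * \<bar>x\<bar> ^ 1) (sqrt (2 / pi))"
      using std_normal_moment_abs_odd[of 0] by simp
    then have "(\<integral>\<^sup>+p. ennreal (std_normal_density p * \<bar>p\<bar> ^ 1) \<partial>lborel) = ennreal (sqrt (2 / pi))"
      by (intro nn_integral_eq_integral[THEN trans]) (auto simp: has_bochner_integral_iff)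
    then show "ennreal (std_normal_density 0 / \<kappa> * \<tau>) * (\<integral>\<^sup>+p. ennreal (std_normal_density p * \<bar>p\<bar> ^ 1) \<partial>lborel)
       = ennreal (std_normal_density 0 / \<kappa> * \<tau>) * ennreal (sqrt (2 / pi))" by simp
  qed measurable
  also have "\<dots> = ennreal (std_normal_density 0 / \<kappa> * \<tau> * sqrt (2 / pi))"
    using k by (intro ennreal_mult[symmetric]) (auto simp: \<tau>_def)
  \<comment> \<open>The two Gaussian constants, 1/sqrt(2\<pi>) from the density at 0 and
    sqrt(2/\<pi>) from the mean modulus, multiply to 1/\<pi>.\<close>
  also have "std_normal_density 0 / \<kappa> * \<tau> * sqrt (2 / pi) = \<tau> / \<kappa> / pi"
    by (simp add: std_normal_density_def real_sqrt_divide real_sqrt_mult)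
  also have "\<tau> / \<kappa> = sqrt ((\<beta>\<^sup>2 + \<gamma>\<^sup>2) * (1 + \<alpha>\<^sup>2) - (\<alpha> * \<beta>)\<^sup>2) / (1 + \<alpha>\<^sup>2)"
  proof -
    have "(\<beta>\<^sup>2 + \<gamma>\<^sup>2) * (1 + \<alpha>\<^sup>2) - (\<alpha> * \<beta>)\<^sup>2 = ((\<beta> / \<kappa>)\<^sup>2 + \<gamma>\<^sup>2) * \<kappa>\<^sup>2"
      using k(1) by (simp add: power_divide distrib_right) (simp add: k(2) power_mult_distrib algebra_simps)
    then have "sqrt ((\<beta>\<^sup>2 + \<gamma>\<^sup>2) * (1 + \<alpha>\<^sup>2) - (\<alpha> * \<beta>)\<^sup>2) = \<tau> * \<kappa>"
      using k(1) by (simp add: \<tau>_def real_sqrt_mult)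
    moreover have "\<tau> / \<kappa> = \<tau> * \<kappa> / \<kappa>\<^sup>2"
      using k(1) by (simp add: power2_eq_square)
    ultimately show ?thesis
      by (simp only: k(2))
  qed
  finally show ?thesis by (simp add: mult.commute)
qed

section \<open>Measurability of zero counts\<close>

text \<open>By compactness a continuous function has a zero on the interval iff its modulus takes
  arbitrarily small values there, and by continuity a countable dense subset already detects this.
  The uncountable existential quantifier thus becomes a countable one.\<close>

lemma sets_zero_in_interval:
  fixes F :: "'a \<Rightarrow> real \<Rightarrow> real"
  assumes [measurable]: "\<And>x. (\<lambda>w. F w x) \<in> borel_measurable M"
    and cont: "\<And>w. w \<in> space M \<Longrightarrow> continuous_on {a..b} (F w)"
  shows "{w \<in> space M. \<exists>x\<in>{a..b}. F w x = 0} \<in> sets M"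
proof -
  obtain D where D: "countable D" "D \<subseteq> {a..b}" "{a..b} \<subseteq> closure D"
    by (rule separable)
  have "(\<exists>x\<in>{a..b}. F w x = 0) \<longleftrightarrow> (\<forall>m::nat. \<exists>x\<in>D. \<bar>F w x\<bar> < 1 / Suc m)"
    if w: "w \<in> space M" for w
  proof (intro iffI allI)
    fix m :: nat
    assume "\<exists>x\<in>{a..b}. F w x = 0"
    then obtain x where x: "x \<in> {a..b}" "F w x = 0" by auto
    obtain d where d: "d > 0" "\<And>y. y \<in> {a..b} \<Longrightarrow> dist y x < d \<Longrightarrow> dist (F w y) (F w x) < 1 / Suc m"
      using cont[OF w] x(1) unfolding continuous_on_iff by (metis of_nat_0_less_iff zero_less_Suc zero_less_divide_1_iff)
    obtain y where y: "y \<in> D" "dist y x < d"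
      using D(3) x(1) d(1) by (meson closure_approachable subsetD)
    then have "\<bar>F w y\<bar> < 1 / Suc m"
      using d(2)[of y] D(2) x(2) by (auto simp: dist_real_def)
    then show "\<exists>x\<in>D. \<bar>F w x\<bar> < 1 / Suc m" using y by blast
  next
    assume *: "\<forall>m::nat. \<exists>x\<in>D. \<bar>F w x\<bar> < 1 / Suc m"
    then have "{a..b} \<noteq> {}" using D(2) by blast
    moreover have "continuous_on {a..b} (\<lambda>x. \<bar>F w x\<bar>)"
      using cont[OF w] by (intro continuous_intros)
    ultimately obtain x where x: "x \<in> {a..b}" "\<And>y. y \<in> {a..b} \<Longrightarrow> \<bar>F w x\<bar> \<le> \<bar>F w y\<bar>"
      using continuous_attains_inf[of "{a..b}" "\<lambda>x. \<bar>F w x\<bar>"] by auto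
    have "\<bar>F w x\<bar> < 1 / Suc m" for m
      using *[rule_format, of m] x(2) D(2) by (meson le_less_trans subsetD)
    then have "\<not> 0 < \<bar>F w x\<bar>"
      by (metis inverse_eq_divide not_less_iff_gr_or_eq reals_Archimedean)
    then show "\<exists>x\<in>{a..b}. F w x = 0" using x(1) by auto
  qed
  then have "{w \<in> space M. \<exists>x\<in>{a..b}. F w x = 0} = {w \<in> space M. \<forall>m::nat. \<exists>x\<in>D. \<bar>F w x\<bar> < 1 / Suc m}"
    by blast
  also have "\<dots> \<in> sets M"
    using D(1) by (intro sets.sets_Collect_countable_All sets.sets_Collect_countable_Bex) measurable
  finally show ?thesis .
qed

text \<open>Half-open intervals are wanted because they can be cut at a point without overlap or
  gap; each is a countable increasing union of compact ones.\<close>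

lemma sets_zero_in_Ioc:
  fixes F :: "'a \<Rightarrow> real \<Rightarrow> real"
  assumes [measurable]: "\<And>x. (\<lambda>w. F w x) \<in> borel_measurable M"
    and cont: "\<And>w. w \<in> space M \<Longrightarrow> continuous_on UNIV (F w)"
  shows "{w \<in> space M. \<exists>x\<in>{a<..b}. F w x = 0} \<in> sets M"
proof -
  have "{a<..b} = (\<Union>m::nat. {a + 1 / Suc m..b})"
  proof (intro set_eqI iffI)
    fix x assume "x \<in> {a<..b}"
    then obtain m :: nat where "1 / Suc m < x - a"
      by (metis diff_gt_0_iff_gt greaterThanAtMost_iff inverse_eq_divide reals_Archimedean)
    then show "x \<in> (\<Union>m::nat. {a + 1 / Suc m..b})"
      using \<open>x \<in> {a<..b}\<close> by (auto intro!: exI[of _ m])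
  next
    fix x assume "x \<in> (\<Union>m::nat. {a + 1 / Suc m..b})"
    then obtain m :: nat where "a + 1 / Suc m \<le> x" "x \<le> b" by auto
    moreover have "0 < 1 / real (Suc m)" by simp
    ultimately show "x \<in> {a<..b}" unfolding greaterThanAtMost_iff by linarith
  qed
  then have "{w \<in> space M. \<exists>x\<in>{a<..b}. F w x = 0}
    = (\<Union>m::nat. {w \<in> space M. \<exists>x\<in>{a + 1 / Suc m..b}. F w x = 0})" by blast
  also have "\<dots> \<in> sets M"
    by (intro sets.countable_nat_UN image_subsetI sets_zero_in_interval assms(1))
       (rule continuous_on_subset[OF cont], auto)
  finally show ?thesis .
qed

text \<open>A rational placed between the two largest points splits off one point and leaves one
  fewer to the left. This expresses the existence of many points by countable unions and drives an
  induction on their number.\<close>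

lemma card_Suc_separated_iff:
  fixes Z :: "real set"
  shows "(\<exists>T\<subseteq>{a<..b} \<inter> Z. finite T \<and> card T = Suc (Suc k)) \<longleftrightarrow>
    (\<exists>q::rat. (\<exists>T\<subseteq>{a<..real_of_rat q} \<inter> Z. finite T \<and> card T = Suc k) \<and> (\<exists>x\<in>{real_of_rat q<..b}. x \<in> Z)
       \<and> real_of_rat q \<le> b \<and> a \<le> real_of_rat q)"
proof
  assume "\<exists>T\<subseteq>{a<..b} \<inter> Z. finite T \<and> card T = Suc (Suc k)"
  then obtain T where T: "T \<subseteq> {a<..b} \<inter> Z" "finite T" "card T = Suc (Suc k)" by auto
  \<comment> \<open>As \<open>T\<close> has at least two points, \<open>T'\<close> is nonempty and
    has a maximum, below which all its points lie.\<close>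
  define T' where "T' = T - {Max T}"
  have ne: "T \<noteq> {}" using T by auto
  then have M: "Max T \<in> T" using T by simp
  have T': "finite T'" "card T' = Suc k" using T M by (auto simp: T'_def)
  then have ne': "T' \<noteq> {}" by auto
  have M': "Max T' \<in> T'" using T' ne' by simp
  have "Max T' < Max T"
    using M' T(2) by (auto simp: T'_def less_le)
  then obtain q where q: "Max T' < real_of_rat q" "real_of_rat q < Max T"
    using of_rat_dense by blast
  have "x \<le> real_of_rat q" if "x \<in> T'" for x
    using Max_ge[OF T'(1) that] q by linarith
  moreover have "T' \<subseteq> {a<..b} \<inter> Z"
    using T(1) by (auto simp: T'_def)
  ultimately have "T' \<subseteq> {a<..real_of_rat q} \<inter> Z" by fastforce
  moreover have "Max T \<in> {real_of_rat q<..b}" "Max T \<in> Z" using q M T(1) by auto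
  moreover have "a \<le> real_of_rat q" "real_of_rat q \<le> b" using q M T(1) M' by (force simp: T'_def)+
  ultimately show "\<exists>q::rat. (\<exists>T\<subseteq>{a<..real_of_rat q} \<inter> Z. finite T \<and> card T = Suc k) \<and> (\<exists>x\<in>{real_of_rat q<..b}. x \<in> Z)
       \<and> real_of_rat q \<le> b \<and> a \<le> real_of_rat q"
    using T' by blast
next
  assume "\<exists>q::rat. (\<exists>T\<subseteq>{a<..real_of_rat q} \<inter> Z. finite T \<and> card T = Suc k) \<and> (\<exists>x\<in>{real_of_rat q<..b}. x \<in> Z)
       \<and> real_of_rat q \<le> b \<and> a \<le> real_of_rat q"
  then obtain q T x where T: "T \<subseteq> {a<..real_of_rat q} \<inter> Z" "finite T" "card T = Suc k"
    and x: "x \<in> {real_of_rat q<..b}" "x \<in> Z" and q: "real_of_rat q \<le> b" "a \<le> real_of_rat q" by blast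
  have "x \<notin> T" using T(1) x by auto
  then have "card (insert x T) = Suc (Suc k)" using T by simp
  moreover have "insert x T \<subseteq> {a<..b} \<inter> Z" using T(1) x q by auto
  ultimately show "\<exists>T\<subseteq>{a<..b} \<inter> Z. finite T \<and> card T = Suc (Suc k)"
    using T(2) by (meson finite_insert)
qed

text \<open>A set has subsets of every finite size up to its own cardinality, and of every finite
  size if it is infinite. The counting measure thus becomes a countable supremum of functions with
  two values, each governed by an event of the kind treated above.\<close>

lemma emeasure_count_space_eq_SUP:
  "emeasure (count_space UNIV) S
    = (SUP k::nat. if \<exists>T\<subseteq>S. finite T \<and> card T = k then of_nat k else 0)"
proof (cases "finite S")
  case True
  show ?thesis
  proof (rule antisym)
    show "emeasure (count_space UNIV) S \<le> (SUP k::nat. if \<exists>T\<subseteq>S. finite T \<and> card T = k then of_nat k else 0)"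
      using True by (intro SUP_upper2[of "card S"]) auto
    show "(SUP k::nat. if \<exists>T\<subseteq>S. finite T \<and> card T = k then of_nat k else 0) \<le> emeasure (count_space UNIV) S"
      using True by (intro SUP_least) (auto intro: card_mono)
  qed
next
  case False
  then have "\<exists>T\<subseteq>S. finite T \<and> card T = k" for k
    using infinite_arbitrarily_large[OF False] by blast
  then have E: "(if \<exists>T\<subseteq>S. finite T \<and> card T = k then of_nat k else 0) = (of_nat k :: ennreal)" for k :: nat
    by auto
  show ?thesis unfolding E using False by (simp add: ennreal_SUP_of_nat_eq_top)
qed

lemma measurable_zero_count_Ioc:
  fixes F :: "'a \<Rightarrow> real \<Rightarrow> real"
  assumes meas: "\<And>x. (\<lambda>w. F w x) \<in> borel_measurable M"
    and cont: "\<And>w. w \<in> space M \<Longrightarrow> continuous_on UNIV (F w)"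
  shows "(\<lambda>w. emeasure (count_space UNIV) ({a<..b} \<inter> {x. F w x = 0})) \<in> borel_measurable M"
proof -
  have 1: "{w \<in> space M. \<exists>T\<subseteq>{a<..b} \<inter> {x. F w x = 0}. finite T \<and> card T = Suc k} \<in> sets M" for k b
  proof (induction k arbitrary: b)
    case 0
    have "(\<exists>T\<subseteq>{a<..b} \<inter> {x. F w x = 0}. finite T \<and> card T = Suc 0) \<longleftrightarrow> (\<exists>x\<in>{a<..b}. F w x = 0)" for w
    proof
      assume "\<exists>T\<subseteq>{a<..b} \<inter> {x. F w x = 0}. finite T \<and> card T = Suc 0"
      then show "\<exists>x\<in>{a<..b}. F w x = 0" by (auto simp: card_Suc_eq)
    next
      assume "\<exists>x\<in>{a<..b}. F w x = 0"
      then obtain x where "{x} \<subseteq> {a<..b} \<inter> {x. F w x = 0}" by auto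
      then show "\<exists>T\<subseteq>{a<..b} \<inter> {x. F w x = 0}. finite T \<and> card T = Suc 0"
        by (intro exI[of _ "{x}"]) auto
    qed
    then show ?case using sets_zero_in_Ioc[of F M a b] meas cont by simp
  next
    case (Suc k)
    show ?case
      unfolding card_Suc_separated_iff mem_Collect_eq
      by (intro sets.sets_Collect sets_zero_in_Ioc meas cont Suc.IH sets.sets_Collect_countable_Ex)
  qed
  have "{w \<in> space M. \<exists>T\<subseteq>{a<..b} \<inter> {x. F w x = 0}. finite T \<and> card T = k} \<in> sets M" for k
  proof (cases k)
    case 0
    then have "{w \<in> space M. \<exists>T\<subseteq>{a<..b} \<inter> {x. F w x = 0}. finite T \<and> card T = k} = space M"
      by (auto intro!: exI[of _ "{}"])
    then show ?thesis by simp
  next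
    case (Suc i)
    then show ?thesis using 1[of b i] by simp
  qed
  then show ?thesis
    unfolding emeasure_count_space_eq_SUP by (intro borel_measurable_SUP measurable_If) auto
qed

text \<open>Dynkin's theorem extends measurability from half-open intervals to Borel sets. Its
  complement step subtracts counts, which is legitimate only if they are finite: hence the guard,
  with default value 0, and the restriction to bounded windows. The windows are removed at the end
  by monotone convergence.\<close>

lemma measurable_zero_count:
  fixes F :: "'a \<Rightarrow> real \<Rightarrow> real"
  assumes meas: "\<And>x. (\<lambda>w. F w x) \<in> borel_measurable M"
    and cont: "\<And>w. w \<in> space M \<Longrightarrow> continuous_on UNIV (F w)"
    and A: "A \<in> sets borel"
  shows "(\<lambda>w. if \<forall>m::nat. finite ({- real m<..real m} \<inter> {x. F w x = 0})
    then emeasure (count_space UNIV) (A \<inter> {x. F w x = 0}) else 0) \<in> borel_measurable M"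
proof -
  define Z where "Z w = {x. F w x = 0}" for w
  define G where "G w \<longleftrightarrow> (\<forall>m::nat. finite ({- real m<..real m} \<inter> Z w))" for w
  define N where "N A w = (if G w then emeasure (count_space UNIV) (A \<inter> Z w) else 0)" for A w
  have meas_Ioc: "(\<lambda>w. emeasure (count_space UNIV) ({a<..b} \<inter> Z w)) \<in> borel_measurable M" for a b
    unfolding Z_def by (rule measurable_zero_count_Ioc[OF meas cont])
  have "{w \<in> space M. G w} = {w \<in> space M. \<forall>m::nat. emeasure (count_space UNIV) ({- real m<..real m} \<inter> Z w) < \<infinity>}"
    by (auto simp: G_def emeasure_count_space less_top[symmetric])
  also have "\<dots> \<in> sets M"
    using meas_Ioc by measurable
  finally have G [measurable]: "Measurable.pred M G" by (simp add: pred_def)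
  have N_Ioc: "N {a<..b} \<in> borel_measurable M" for a b
    unfolding N_def using meas_Ioc[of a b] by measurable
  have step: "N (A \<inter> {- real m<..real m}) \<in> borel_measurable M" for m :: nat
  proof -
    let ?I = "{- real m<..real m}"
    have fin: "finite (?I \<inter> Z w)" if "G w" for w using that by (auto simp: G_def)
    have "Int_stable (range (\<lambda>(a, b). {a<..b::real}))"
      by (auto simp: Int_stable_def)
    moreover have "range (\<lambda>(a, b). {a<..b::real}) \<subseteq> Pow UNIV" by simp
    moreover have "A \<in> sigma_sets UNIV (range (\<lambda>(a, b). {a<..b::real}))"
      using A by (simp add: borel_sigma_sets_Ioc)
    ultimately show ?thesis
    proof (induction rule: sigma_sets_induct_disjoint)
      case (basic A)
      then show ?case using N_Ioc by auto
    next
      case empty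
      have "N ({} \<inter> ?I) = (\<lambda>_. 0)" by (rule ext) (auto simp: N_def)
      then show ?case by simp
    next
      case (compl A)
      have "N ((UNIV - A) \<inter> ?I) = (\<lambda>w. N ?I w - N (A \<inter> ?I) w)"
      proof
        fix w
        show "N ((UNIV - A) \<inter> ?I) w = N ?I w - N (A \<inter> ?I) w"
        proof (cases "G w")
          case True
          have "(UNIV - A) \<inter> ?I \<inter> Z w = (?I \<inter> Z w) - (A \<inter> ?I \<inter> Z w)" by auto
          moreover have "emeasure (count_space UNIV) ((?I \<inter> Z w) - (A \<inter> ?I \<inter> Z w)) =
            emeasure (count_space UNIV) (?I \<inter> Z w) - emeasure (count_space UNIV) (A \<inter> ?I \<inter> Z w)"
            using fin[OF True] by (intro emeasure_Diff) (auto simp: emeasure_count_space intro: finite_subset)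
          ultimately show ?thesis using True by (simp add: N_def)
        qed (simp add: N_def)
      qed
      then show ?case using N_Ioc compl by simp
    next
      case (union A)
      have "N ((\<Union>i. A i) \<inter> ?I) = (\<lambda>w. \<Sum>i. N (A i \<inter> ?I) w)"
      proof
        fix w
        have 1: "emeasure (count_space UNIV) (\<Union>i. A i \<inter> ?I \<inter> Z w) = (\<Sum>i. emeasure (count_space UNIV) (A i \<inter> ?I \<inter> Z w))"
          using union(1) by (intro suminf_emeasure[symmetric]) (auto simp: disjoint_family_on_def)
        have 2: "(\<Union>i. A i) \<inter> ?I \<inter> Z w = (\<Union>i. A i \<inter> ?I \<inter> Z w)" by auto
        show "N ((\<Union>i. A i) \<inter> ?I) w = (\<Sum>i. N (A i \<inter> ?I) w)"
          unfolding N_def 1 2 by (cases "G w") simp_all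
      qed
      then show ?case using union by simp
    qed
  qed
  have "N A = (\<lambda>w. SUP m. N (A \<inter> {- real m<..real m}) w)"
  proof
    fix w
    have 1: "A \<inter> Z w = (\<Union>m::nat. A \<inter> {- real m<..real m} \<inter> Z w)"
    proof -
      have "\<exists>m::nat. x \<in> {- real m<..real m}" for x
      proof -
        obtain m :: nat where "\<bar>x\<bar> < real m" using reals_Archimedean2 by blast
        then show ?thesis by (intro exI[of _ m]) auto
      qed
      then show ?thesis by blast
    qed
    have 2: "emeasure (count_space UNIV) (\<Union>m::nat. A \<inter> {- real m<..real m} \<inter> Z w) =
       (SUP m. emeasure (count_space UNIV) (A \<inter> {- real m<..real m} \<inter> Z w))"
      by (intro SUP_emeasure_incseq[symmetric]) (auto simp: incseq_def)
    show "N A w = (SUP m. N (A \<inter> {- real m<..real m}) w)"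
      unfolding N_def 1 2 by (cases "G w") simp_all
  qed
  then have "N A \<in> borel_measurable M"
    using step by simp
  moreover have "N A = (\<lambda>w. if \<forall>m::nat. finite ({- real m<..real m} \<inter> {x. F w x = 0})
    then emeasure (count_space UNIV) (A \<inter> {x. F w x = 0}) else 0)"
    by (simp add: fun_eq_iff N_def G_def Z_def)
  ultimately show ?thesis by simp
qed

section \<open>Real entire functions\<close>

locale real_entire_family =
  fixes n :: nat and f :: "nat \<Rightarrow> complex \<Rightarrow> complex"
  assumes holomorphic: "\<And>j. j \<le> n \<Longrightarrow> f j holomorphic_on UNIV"
    and real_on_reals: "\<And>j x. j \<le> n \<Longrightarrow> f j (complex_of_real x) \<in> \<real>"
begin

section \<open>Restriction to the real line\<close>

definition r :: "nat \<Rightarrow> real \<Rightarrow> real" where "r j x = Re (f j (complex_of_real x))"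
definition r' :: "nat \<Rightarrow> real \<Rightarrow> real" where "r' j x = Re (deriv (f j) (complex_of_real x))"
definition Q :: "(nat \<Rightarrow> real) \<Rightarrow> real \<Rightarrow> real" where "Q w x = (\<Sum>j\<le>n. w j * r j x)"
definition Q' :: "(nat \<Rightarrow> real) \<Rightarrow> real \<Rightarrow> real" where "Q' w x = (\<Sum>j\<le>n. w j * r' j x)"
definition U :: "nat \<Rightarrow> real set" where "U k = {x. r k x \<noteq> 0}"

lemma of_real_r: "j \<le> n \<Longrightarrow> complex_of_real (r j x) = f j (complex_of_real x)"
  unfolding r_def using real_on_reals[of j x] by simp

lemma field_derivative_f:
  "j \<le> n \<Longrightarrow> (f j has_field_derivative deriv (f j) z) (at z)"
  using holomorphic by (metis UNIV_I holomorphic_derivI open_UNIV)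

text \<open>The imaginary part of \<open>f j\<close> is identically 0 along the real line, so its
  derivative in the real direction is 0 too. This makes the complex derivative real there and equal
  to the derivative of the real restriction.\<close>

lemma
  assumes j: "j \<le> n"
  shows has_derivative_r: "(r j has_real_derivative r' j x) (at x)"
    and of_real_r': "complex_of_real (r' j x) = deriv (f j) (complex_of_real x)"
proof -
  have v: "((\<lambda>x. f j (complex_of_real x)) has_vector_derivative deriv (f j) (complex_of_real x)) (at x)"
    by (rule has_vector_derivative_real_field[OF field_derivative_f[OF j]])
  show "(r j has_real_derivative r' j x) (at x)"
    unfolding r_def r'_def using has_field_derivative_Re[OF v] by simp
  have "((\<lambda>x. Im (f j (complex_of_real x))) has_real_derivative Im (deriv (f j) (complex_of_real x))) (at x)"
    by (rule has_field_derivative_Im[OF v])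
  moreover have "(\<lambda>x. Im (f j (complex_of_real x))) = (\<lambda>_. 0)"
    using real_on_reals[OF j] by (auto simp: complex_is_Real_iff)
  ultimately have "((\<lambda>_. 0) has_real_derivative Im (deriv (f j) (complex_of_real x))) (at x)" by simp
  then have "Im (deriv (f j) (complex_of_real x)) = 0"
    using DERIV_const DERIV_unique by blast
  then show "complex_of_real (r' j x) = deriv (f j) (complex_of_real x)"
    by (simp add: r'_def complex_eq_iff)
qed

lemma continuous_r: "j \<le> n \<Longrightarrow> continuous_on S (r j)"
  by (meson DERIV_continuous_on has_derivative_r has_field_derivative_at_within)

lemma continuous_r': "j \<le> n \<Longrightarrow> continuous_on S (r' j)"
proof -
  assume "j \<le> n"
  then have "deriv (f j) holomorphic_on UNIV"
    by (intro holomorphic_deriv holomorphic) auto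
  then have "continuous_on UNIV (deriv (f j))"
    by (rule holomorphic_on_imp_continuous_on)
  then have "continuous_on S (\<lambda>x. deriv (f j) (complex_of_real x))"
    by (rule continuous_on_compose2) (auto intro: continuous_intros)
  then show ?thesis unfolding r'_def by (intro continuous_intros)
qed

lemma borel_measurable_r [measurable]: "j \<le> n \<Longrightarrow> r j \<in> borel_measurable borel"
  by (intro borel_measurable_continuous_onI continuous_r)

lemma borel_measurable_r' [measurable]: "j \<le> n \<Longrightarrow> r' j \<in> borel_measurable borel"
  by (intro borel_measurable_continuous_onI continuous_r')

lemma open_U: "k \<le> n \<Longrightarrow> open (U k)"
  unfolding U_def by (intro open_Collect_neq continuous_r continuous_intros)

lemma continuous_Q: "continuous_on S (Q w)"
  unfolding Q_def by (intro continuous_intros continuous_r) auto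

lemma continuous_Q': "continuous_on S (Q' w)"
  unfolding Q'_def by (intro continuous_intros continuous_r') auto

lemma random_sum_of_real:
  "random_sum n f \<eta> \<omega> (complex_of_real x) = complex_of_real (Q (\<lambda>j. \<eta> j \<omega>) x)"
  unfolding random_sum_def Q_def by (simp add: of_real_r)

lemma random_sum_holomorphic: "random_sum n f \<eta> \<omega> holomorphic_on S"
  unfolding random_sum_def
  by (intro holomorphic_intros holomorphic_on_subset[OF holomorphic]) auto

lemma deriv_random_sum_of_real:
  "deriv (random_sum n f \<eta> \<omega>) (complex_of_real x) = complex_of_real (Q' (\<lambda>j. \<eta> j \<omega>) x)"
proof -
  have "(random_sum n f \<eta> \<omega> has_field_derivative (\<Sum>j\<le>n. of_real (\<eta> j \<omega>) * deriv (f j) (of_real x))) (at (of_real x))"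
    unfolding random_sum_def by (intro DERIV_sum DERIV_cmult field_derivative_f) auto
  then have "deriv (random_sum n f \<eta> \<omega>) (complex_of_real x) = (\<Sum>j\<le>n. of_real (\<eta> j \<omega>) * deriv (f j) (of_real x))"
    by (rule DERIV_imp_deriv)
  then show ?thesis by (simp add: Q'_def of_real_r')
qed

section \<open>The number of real zeros as a function of the coefficients\<close>

lemma finite_bounded_zeros:
  assumes "Q w x0 \<noteq> 0"
  shows "finite ({a<..b} \<inter> {x. Q w x = 0})"
proof -
  \<comment> \<open>The coefficient vector itself serves as sample point and the coordinates as
    random variables, so that the facts on \<open>random_sum\<close> apply to \<open>Q w\<close>.
    Its zeros in a compact set are finite in number unless it is constant, and a constant
    \<open>Q w\<close> is nonzero by assumption.\<close>
  let ?P = "random_sum n f (\<lambda>j w. w j) w"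
  let ?K = "complex_of_real ` {a..b}"
  have "compact ?K"
    by (intro compact_continuous_image continuous_intros compact_Icc)
  show ?thesis
  proof (cases "?P constant_on UNIV")
    case True
    then have "Q w x \<noteq> 0" for x
      using random_sum_of_real[of "\<lambda>j w. w j" w] assms unfolding constant_on_def
      by (metis UNIV_I of_real_eq_0_iff)
    then show ?thesis by simp
  next
    case False
    then have fin: "finite {z \<in> ?K. ?P z = 0}"
      by (intro holomorphic_compact_finite_zeros[of _ UNIV] random_sum_holomorphic \<open>compact ?K\<close>) auto
    have "complex_of_real ` ({a<..b} \<inter> {x. Q w x = 0}) \<subseteq> {z \<in> ?K. ?P z = 0}"
      by (auto simp: random_sum_of_real)
    from finite_subset[OF this fin] show ?thesis
      by (rule finite_imageD) (simp add: inj_on_def)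
  qed
qed

text \<open>Counts distinct real zeros. By \<open>finite_bounded_zeros\<close> the guard fails only
  if \<open>Q w\<close> vanishes identically, and there the default 0 keeps \<open>N\<close>
  measurable in \<open>w\<close> and additive in \<open>A\<close>.\<close>

definition N :: "real set \<Rightarrow> (nat \<Rightarrow> real) \<Rightarrow> ennreal" where
  "N A w = (if \<forall>m::nat. finite ({- real m<..real m} \<inter> {x. Q w x = 0})
    then emeasure (count_space UNIV) (A \<inter> {x. Q w x = 0}) else 0)"

lemma N_eq: "Q w x0 \<noteq> 0 \<Longrightarrow> N A w = emeasure (count_space UNIV) (A \<inter> {x. Q w x = 0})"
  unfolding N_def using finite_bounded_zeros by meson

abbreviation "gauss \<equiv> Pi\<^sub>M {..n} (\<lambda>_. std_gauss)"
abbreviation "gauss_except k \<equiv> Pi\<^sub>M ({..n} - {k}) (\<lambda>_. std_gauss)"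

lemma measurable_Q: "(\<lambda>w. Q w x) \<in> borel_measurable gauss"
  unfolding Q_def by measurable

lemma measurable_Q': "(\<lambda>w. Q' w x) \<in> borel_measurable gauss"
  unfolding Q'_def by measurable

lemma measurable_N [measurable]: "A \<in> sets borel \<Longrightarrow> N A \<in> borel_measurable gauss"
  unfolding N_def by (rule measurable_zero_count[OF measurable_Q continuous_Q])

lemma nn_integral_gauss_except:
  assumes "k \<le> n" and [measurable]: "F \<in> borel_measurable gauss"
  shows "(\<integral>\<^sup>+w. F w \<partial>gauss) = (\<integral>\<^sup>+w. (\<integral>\<^sup>+y. F (w(k := y)) \<partial>std_gauss) \<partial>gauss_except k)"
proof -
  have "{..n} = insert k ({..n} - {k})" using assms(1) by auto
  then show ?thesis
    using std_gauss_product.product_nn_integral_insert[of "{..n} - {k}" k F] assms(2) by simp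
qed

text \<open>On \<open>U k\<close> the zeros of \<open>Q w\<close> are the solutions of \<open>h k w x = w k\<close>, and the double zeros
  are the critical points of \<open>h k w\<close> among them.\<close>

definition u :: "nat \<Rightarrow> nat \<Rightarrow> real \<Rightarrow> real" where "u k j x = r j x / r k x"
definition v :: "nat \<Rightarrow> nat \<Rightarrow> real \<Rightarrow> real" where
  "v k j x = (r' j x * r k x - r j x * r' k x) / (r k x * r k x)"
definition h :: "nat \<Rightarrow> (nat \<Rightarrow> real) \<Rightarrow> real \<Rightarrow> real" where
  "h k w x = - (\<Sum>j\<in>{..n}-{k}. u k j x * w j)"
definition h' :: "nat \<Rightarrow> (nat \<Rightarrow> real) \<Rightarrow> real \<Rightarrow> real" where
  "h' k w x = - (\<Sum>j\<in>{..n}-{k}. v k j x * w j)"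

lemma has_derivative_h:
  assumes "k \<le> n" "x \<in> U k"
  shows "(h k w has_real_derivative h' k w x) (at x)"
proof -
  have "(u k j has_real_derivative v k j x) (at x)" if "j \<le> n" for j
    unfolding u_def v_def using assms that
    by (intro DERIV_divide has_derivative_r) (auto simp: U_def)
  then show ?thesis
    unfolding h_def h'_def by (intro DERIV_minus DERIV_sum DERIV_cmult_right) auto
qed

lemma continuous_h': "k \<le> n \<Longrightarrow> continuous_on (U k) (h' k w)"
  unfolding h'_def v_def
  by (intro continuous_intros continuous_r continuous_r') (auto simp: U_def)

lemma
  assumes k: "k \<le> n" "x \<in> U k"
  shows Q_upd: "Q (w(k := y)) x = r k x * (y - h k w x)"
    and Q'_upd: "Q' (w(k := y)) x = r' k x * (y - h k w x) - r k x * h' k w x"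
proof -
  have nz: "r k x \<noteq> 0" using k by (simp add: U_def)
  have split: "(\<Sum>j\<le>n. (w(k := y)) j * g j) = y * g k + (\<Sum>j\<in>{..n}-{k}. w j * g j)" for g :: "nat \<Rightarrow> real"
  proof -
    have "(\<Sum>j\<le>n. (w(k := y)) j * g j) = (w(k := y)) k * g k + (\<Sum>j\<in>{..n}-{k}. (w(k := y)) j * g j)"
      using k(1) by (intro sum.remove) auto
    also have "(\<Sum>j\<in>{..n}-{k}. (w(k := y)) j * g j) = (\<Sum>j\<in>{..n}-{k}. w j * g j)"
      by (intro sum.cong) auto
    finally show ?thesis by simp
  qed
  have h: "r k x * h k w x = - (\<Sum>j\<in>{..n}-{k}. w j * r j x)"
    unfolding h_def u_def using nz by (simp add: sum_distrib_left mult.commute)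
  \<comment> \<open>The derivative of the preceding identity by the product rule, checked term by
    term.\<close>
  have h': "r k x * h' k w x + r' k x * h k w x = - (\<Sum>j\<in>{..n}-{k}. w j * r' j x)"
  proof -
    have "r k x * (v k j x * w j) + r' k x * (u k j x * w j) = w j * r' j x" for j
      unfolding u_def v_def using nz by (simp add: field_simps)
    then have "(\<Sum>j\<in>{..n}-{k}. r k x * (v k j x * w j)) + (\<Sum>j\<in>{..n}-{k}. r' k x * (u k j x * w j))
        = (\<Sum>j\<in>{..n}-{k}. w j * r' j x)"
      by (simp only: sum.distrib[symmetric])
    then show ?thesis
      unfolding h_def h'_def by (simp add: sum_distrib_left)
  qed
  show "Q (w(k := y)) x = r k x * (y - h k w x)"
    unfolding Q_def split using h by (simp add: algebra_simps)
  show "Q' (w(k := y)) x = r' k x * (y - h k w x) - r k x * h' k w x"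
    unfolding Q'_def split using h' by (simp add: algebra_simps)
qed

lemma Q_upd_eq_0_iff: "k \<le> n \<Longrightarrow> x \<in> U k \<Longrightarrow> Q (w(k := y)) x = 0 \<longleftrightarrow> h k w x = y"
  by (auto simp: Q_upd U_def)

section \<open>Almost sure absence of double zeros\<close>

text \<open>With the other coefficients fixed, \<open>w k\<close> has to avoid a null set of
  critical values. To integrate this over the other coefficients, the bad event is written over
  countably many compact rational intervals inside \<open>U k\<close>, which makes it
  measurable.\<close>

lemma AE_gauss_no_double_zero:
  assumes k: "k \<le> n"
  shows "AE w in gauss. \<forall>x\<in>U k. Q w x = 0 \<longrightarrow> Q' w x \<noteq> 0"
proof -
  define I where "I = (\<lambda>(a, b). {real_of_rat a..real_of_rat b} :: real set)"
  define X where "X = {p. I p \<subseteq> U k}"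
  \<comment> \<open>Adding moduli turns the two equations of a double zero into one equation for a
    single continuous function, to which \<open>sets_zero_in_interval\<close> applies.\<close>
  define D where "D = {w \<in> space gauss. \<exists>p\<in>X. \<exists>x\<in>I p. \<bar>Q w x\<bar> + \<bar>Q' w x\<bar> = 0}"
  have cover: "\<exists>p\<in>X. x \<in> I p" if x: "x \<in> U k" for x
  proof -
    obtain e where e: "e > 0" "ball x e \<subseteq> U k"
      using openE[OF open_U[OF k] x] by blast
    obtain p where p: "x - e < real_of_rat p" "real_of_rat p < x"
      using of_rat_dense[of "x - e" x] e by auto
    obtain q where q: "x < real_of_rat q" "real_of_rat q < x + e"
      using of_rat_dense[of x "x + e"] e by auto
    have "{real_of_rat p..real_of_rat q} \<subseteq> ball x e"
      using p q by (auto simp: dist_real_def)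
    then show ?thesis
      using e p q by (intro bexI[of _ "(p, q)"]) (auto simp: X_def I_def)
  qed
  have "{w \<in> space gauss. \<exists>x\<in>I p. \<bar>Q w x\<bar> + \<bar>Q' w x\<bar> = 0} \<in> sets gauss" for p
    unfolding I_def prod.case_eq_if
    using measurable_Q measurable_Q' continuous_Q continuous_Q'
    by (intro sets_zero_in_interval borel_measurable_add borel_measurable_abs continuous_intros) auto
  then have D [measurable]: "D \<in> sets gauss"
    unfolding D_def by (intro sets.sets_Collect_countable_Bex) auto
  have "emeasure gauss D = (\<integral>\<^sup>+w. indicator D w \<partial>gauss)" by simp
  also have "\<dots> = (\<integral>\<^sup>+w. (\<integral>\<^sup>+y. indicator D (w(k := y)) \<partial>std_gauss) \<partial>gauss_except k)"
    by (rule nn_integral_gauss_except[OF k]) measurable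
  also have "\<dots> = (\<integral>\<^sup>+w. 0 \<partial>gauss_except k)"
  proof (rule nn_integral_cong)
    fix w assume w: "w \<in> space (gauss_except k)"
    define C where "C = {x \<in> U k. h' k w x = 0}"
    have "(h k w has_real_derivative 0) (at x)" if "x \<in> C" for x
      using has_derivative_h[OF k, of x w] that by (simp add: C_def)
    then have "negligible (h k w ` C)"
      by (rule negligible_critical_values)
    then have "AE y in lebesgue. y \<notin> h k w ` C"
      by (simp add: negligible_iff_null_sets AE_not_in)
    then have crit: "AE y in lborel. y \<notin> h k w ` C"
      by (simp only: AE_completion_iff)
    have "AE y in std_gauss. indicator D (w(k := y)) = (0 :: ennreal)"
    proof -
      have *: "indicator D (w(k := y)) = (0 :: ennreal)" if y: "y \<notin> h k w ` C" for y
      proof -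
        have "w(k := y) \<notin> D"
        proof
          assume "w(k := y) \<in> D"
          then obtain x where x: "x \<in> U k" "Q (w(k := y)) x = 0" "Q' (w(k := y)) x = 0"
            unfolding D_def X_def by fastforce
          then have "h k w x = y" using Q_upd_eq_0_iff[OF k] by simp
          moreover have "r k x \<noteq> 0" using x by (simp add: U_def)
          \<comment> \<open>At y = \<open>h k w x\<close> the formula for \<open>Q'\<close> reduces
            to \<open>- r k x * h' k w x\<close>.\<close>
          ultimately have "h' k w x = 0" using x Q'_upd[OF k x(1), of w y] by simp
          then show False using y x(1) \<open>h k w x = y\<close> by (auto simp: C_def)
        qed
        then show ?thesis by simp
      qed
      have "AE y in lborel. indicator D (w(k := y)) = (0 :: ennreal)"
        using crit by (rule AE_mp) (auto simp: *)
      then show ?thesis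
        unfolding std_gauss_def by (subst AE_density) auto
    qed
    then show "(\<integral>\<^sup>+y. indicator D (w(k := y)) \<partial>std_gauss) = 0"
      using nn_integral_cong_AE[of "\<lambda>y. indicator D (w(k := y))" "\<lambda>_. 0" std_gauss] by simp
  qed
  finally have "D \<in> null_sets gauss" using D by (simp add: null_sets_def)
  then have "AE w in gauss. w \<notin> D" by (rule AE_not_in)
  then show ?thesis
  proof (rule AE_mp, intro AE_I2 impI ballI notI)
    fix w x assume w: "w \<in> space gauss" "w \<notin> D" and x: "x \<in> U k" "Q w x = 0" "Q' w x = 0"
    obtain p where "p \<in> X" "x \<in> I p" using cover[OF x(1)] by blast
    then have "\<exists>p\<in>X. \<exists>x\<in>I p. \<bar>Q w x\<bar> + \<bar>Q' w x\<bar> = 0"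
      using x by (intro bexI[of _ p] bexI[of _ x]) simp_all
    then show False using w by (simp add: D_def)
  qed
qed

section \<open>Expected count where one \<open>r k\<close> does not vanish\<close>

text \<open>For fixed other coefficients the zeros in \<open>A\<close> are the solutions of
  \<open>h k w x = y\<close>, so this is the area formula with the law of the coefficient y as
  weight.\<close>

lemma nn_integral_N_section:
  assumes k: "k \<le> n" and A: "A \<in> sets borel" "A \<subseteq> U k"
  shows "(\<integral>\<^sup>+y. N A (w(k := y)) \<partial>std_gauss)
    = (\<integral>\<^sup>+x. ennreal (std_normal_density (h k w x) * \<bar>h' k w x\<bar>) * indicator A x \<partial>lborel)"
proof -
  have m: "(\<lambda>y. N A (w(k := y))) \<in> borel_measurable borel"
    unfolding N_def
  proof (rule measurable_zero_count[OF _ continuous_Q A(1)])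
    fix x
    have "(\<lambda>y. (w(k := y)) j) \<in> borel_measurable borel" for j
      by (cases "j = k") auto
    then show "(\<lambda>y. Q (w(k := y)) x) \<in> borel_measurable borel"
      unfolding Q_def by measurable
  qed
  have "AE y in lebesgue. N A (w(k := y)) = emeasure (count_space UNIV) {x \<in> A. h k w x = y}"
  proof (cases "A = {}")
    case True
    then show ?thesis by (simp add: N_def)
  next
    case False
    then obtain x0 where x0: "x0 \<in> A" by auto
    \<comment> \<open>The single point \<open>x0\<close> shows that \<open>Q (w(k := y))\<close> is
      not identically zero unless y is the one value \<open>h k w x0\<close>; hence the default
      value in \<open>N\<close> affects at most one y.\<close>
    have "AE y in lborel. y \<noteq> h k w x0" by (rule AE_lborel_singleton)
    then have "AE y in lebesgue. y \<noteq> h k w x0" by (rule AE_completion)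
    then show ?thesis
    proof (rule AE_mp, intro AE_I2 impI)
      fix y assume "y \<noteq> h k w x0"
      then have "Q (w(k := y)) x0 \<noteq> 0"
        using x0 A Q_upd_eq_0_iff[OF k, of x0] by auto
      then have "N A (w(k := y)) = emeasure (count_space UNIV) (A \<inter> {x. Q (w(k := y)) x = 0})"
        by (rule N_eq)
      also have "A \<inter> {x. Q (w(k := y)) x = 0} = {x \<in> A. h k w x = y}"
        using A(2) Q_upd_eq_0_iff[OF k, of _ w y] by blast
      finally show "N A (w(k := y)) = emeasure (count_space UNIV) {x \<in> A. h k w x = y}" .
    qed
  qed
  then have ae: "AE y in lebesgue. ennreal (std_normal_density y) * N A (w(k := y))
    = ennreal (std_normal_density y) * emeasure (count_space UNIV) {x \<in> A. h k w x = y}"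
    by (rule AE_mp) auto
  have "(\<integral>\<^sup>+y. N A (w(k := y)) \<partial>std_gauss) = (\<integral>\<^sup>+y. ennreal (std_normal_density y) * N A (w(k := y)) \<partial>lebesgue)"
    using m by (simp add: nn_integral_std_gauss nn_integral_completion)
  also have "\<dots> = (\<integral>\<^sup>+y. ennreal (std_normal_density y) * emeasure (count_space UNIV) {x \<in> A. h k w x = y} \<partial>lebesgue)"
    by (rule nn_integral_cong_AE[OF ae])
  also have "\<dots> = (\<integral>\<^sup>+x. ennreal (std_normal_density (h k w x) * \<bar>h' k w x\<bar>) * indicator A x \<partial>lborel)"
    by (rule area_formula_real[OF open_U[OF k] A has_derivative_h[OF k] continuous_h'[OF k]]) auto
  finally show ?thesis .
qed

text \<open>The Gram determinant of the vectors (1, u) and (0, v): the curve normalised to have k-th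
  coordinate 1, and its derivative.\<close>

definition gram :: "nat \<Rightarrow> real \<Rightarrow> real" where
  "gram k x = (\<Sum>j\<in>{..n}-{k}. (v k j x)\<^sup>2) * (1 + (\<Sum>j\<in>{..n}-{k}. (u k j x)\<^sup>2)) - (\<Sum>j\<in>{..n}-{k}. u k j x * v k j x)\<^sup>2"

lemma nn_integral_density_abs_h:
  "(\<integral>\<^sup>+w. ennreal (std_normal_density (h k w x) * \<bar>h' k w x\<bar>) \<partial>gauss_except k)
    = ennreal (sqrt (gram k x) / (pi * (1 + (\<Sum>j\<in>{..n}-{k}. (u k j x)\<^sup>2))))"
proof -
  let ?J = "{..n} - {k}"
  obtain \<alpha> \<beta> \<gamma> where rep: "\<alpha>\<^sup>2 = (\<Sum>j\<in>?J. (u k j x)\<^sup>2)" "\<alpha> * \<beta> = (\<Sum>j\<in>?J. u k j x * v k j x)"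
      "\<beta>\<^sup>2 + \<gamma>\<^sup>2 = (\<Sum>j\<in>?J. (v k j x)\<^sup>2)" and
      F: "\<And>F :: real \<times> real \<Rightarrow> ennreal. F \<in> borel_measurable (borel \<Otimes>\<^sub>M borel) \<Longrightarrow>
        (\<integral>\<^sup>+w. F (\<Sum>j\<in>?J. u k j x * w j, \<Sum>j\<in>?J. v k j x * w j) \<partial>gauss_except k) =
        (\<integral>\<^sup>+t. (\<integral>\<^sup>+s. F (\<alpha> * s, \<beta> * s + \<gamma> * t) \<partial>std_gauss) \<partial>std_gauss)"
    using gaussian_pair_representation[of ?J "\<lambda>j. u k j x" "\<lambda>j. v k j x"] by auto
  have "(\<integral>\<^sup>+w. ennreal (std_normal_density (h k w x) * \<bar>h' k w x\<bar>) \<partial>gauss_except k)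
    = (\<integral>\<^sup>+w. (\<lambda>(a, b). ennreal (std_normal_density a * \<bar>b\<bar>)) (\<Sum>j\<in>?J. u k j x * w j, \<Sum>j\<in>?J. v k j x * w j) \<partial>gauss_except k)"
    \<comment> \<open>The minus signs in \<open>h\<close> and \<open>h'\<close> disappear because
      the normal density is even and the derivative enters by its modulus.\<close>
    by (simp add: h_def h'_def std_normal_density_def)
  also have "\<dots> = (\<integral>\<^sup>+t. (\<integral>\<^sup>+s. (\<lambda>(a, b). ennreal (std_normal_density a * \<bar>b\<bar>)) (\<alpha> * s, \<beta> * s + \<gamma> * t) \<partial>std_gauss) \<partial>std_gauss)"
    by (rule F) measurable
  also have "\<dots> = ennreal (sqrt ((\<beta>\<^sup>2 + \<gamma>\<^sup>2) * (1 + \<alpha>\<^sup>2) - (\<alpha> * \<beta>)\<^sup>2) / (pi * (1 + \<alpha>\<^sup>2)))"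
    using nn_integral_std_gauss_density_abs[of \<alpha> \<beta> \<gamma>] by simp
  finally show ?thesis by (simp add: gram_def rep)
qed

section \<open>The density on the real line\<close>

lemma A0_of_real: "A0 n f (complex_of_real x) = complex_of_real (\<Sum>j\<le>n. (r j x)\<^sup>2)"
  unfolding A0_def by (simp add: of_real_r[symmetric])

lemma A1_of_real: "A1 n f (complex_of_real x) = complex_of_real (\<Sum>j\<le>n. r j x * r' j x)"
  unfolding A1_def by (simp add: of_real_r[symmetric] of_real_r'[symmetric])

lemma A2_of_real: "A2 n f (complex_of_real x) = complex_of_real (\<Sum>j\<le>n. (r' j x)\<^sup>2)"
  unfolding A2_def by (simp add: of_real_r'[symmetric])

lemma B0_of_real: "B0 n f (complex_of_real x) = (\<Sum>j\<le>n. (r j x)\<^sup>2)"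
  unfolding B0_def by (simp add: of_real_r[symmetric])

lemma D0_of_real: "D0 n f (complex_of_real x) = 0"
  unfolding D0_def A0_of_real B0_of_real by (simp del: of_real_sum)

lemma g_density_eq:
  "g_density n f x = sqrt ((\<Sum>j\<le>n. (r' j x)\<^sup>2) * (\<Sum>j\<le>n. (r j x)\<^sup>2) - (\<Sum>j\<le>n. r j x * r' j x)\<^sup>2)
    / (pi * (\<Sum>j\<le>n. (r j x)\<^sup>2))"
proof -
  define a0 where "a0 = (\<Sum>j\<le>n. (r j x)\<^sup>2)"
  define a1 where "a1 = (\<Sum>j\<le>n. r j x * r' j x)"
  define a2 where "a2 = (\<Sum>j\<le>n. (r' j x)\<^sup>2)"
  have nn: "a2 * a0 - a1\<^sup>2 \<ge> 0"
    unfolding a0_def a1_def a2_def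
    using Cauchy_Schwarz_ineq_sum[of "\<lambda>j. r j x" "\<lambda>j. r' j x" "{..n}"] by (simp add: mult.commute)
  have "E1 n f (complex_of_real x) = csqrt (complex_of_real (a2 * a0 - a1\<^sup>2))"
    unfolding E1_def A0_of_real A1_of_real A2_of_real a0_def[symmetric] a1_def[symmetric] a2_def[symmetric]
    by simp
  also have "\<dots> = complex_of_real (sqrt (a2 * a0 - a1\<^sup>2))"
    using nn by (subst csqrt_of_real_nonneg) simp_all
  finally show ?thesis
    unfolding g_density_def B0_of_real a0_def[symmetric] a1_def[symmetric] a2_def[symmetric]
    by (simp only: Re_complex_of_real flip: of_real_divide)
qed

lemma borel_measurable_g_density [measurable]: "g_density n f \<in> borel_measurable borel"
proof -
  have "(\<lambda>x. sqrt ((\<Sum>j\<le>n. (r' j x)\<^sup>2) * (\<Sum>j\<le>n. (r j x)\<^sup>2) - (\<Sum>j\<le>n. r j x * r' j x)\<^sup>2)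
    / (pi * (\<Sum>j\<le>n. (r j x)\<^sup>2))) \<in> borel_measurable borel"
    by (intro borel_measurable_divide borel_measurable_times borel_measurable_sqrt borel_measurable_diff
      borel_measurable_power borel_measurable_sum borel_measurable_const borel_measurable_r borel_measurable_r') auto
  then show ?thesis by (simp add: g_density_eq[abs_def])
qed

text \<open>The Gram determinant of \<open>(r j)\<close> and its derivative \<open>(r' j)\<close> scales by the fourth power
  of \<open>r k\<close> when the curve is normalised to have \<open>k\<close>-th coordinate \<open>1\<close>.\<close>

lemma g_density_eq_gram:
  assumes k: "k \<le> n" "x \<in> U k"
  shows "g_density n f x = sqrt (gram k x) / (pi * (1 + (\<Sum>j\<in>{..n}-{k}. (u k j x)\<^sup>2)))"
proof -
  define \<rho> \<rho>' where "\<rho> = r k x" and "\<rho>' = r' k x"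
  have nz: "\<rho> \<noteq> 0" using k by (simp add: U_def \<rho>_def)
  define su where "su = (\<Sum>j\<in>{..n}-{k}. (u k j x)\<^sup>2)"
  define sv where "sv = (\<Sum>j\<in>{..n}-{k}. (v k j x)\<^sup>2)"
  define suv where "suv = (\<Sum>j\<in>{..n}-{k}. u k j x * v k j x)"
  have rj: "r j x = \<rho> * u k j x" for j
    using nz by (simp add: u_def \<rho>_def)
  \<comment> \<open>The product rule for \<open>r j = r k * u k j\<close>. Together with the line
    above it expresses (r, r') through (u, v) by a triangular matrix with both diagonal entries
    \<rho>.\<close>
  have r'j: "r' j x = \<rho> * v k j x + \<rho>' * u k j x" for j
    using nz by (simp add: u_def v_def \<rho>_def \<rho>'_def field_simps)
  have split: "(\<Sum>j\<le>n. g j) = g k + (\<Sum>j\<in>{..n}-{k}. g j)" for g :: "nat \<Rightarrow> real"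
    using k(1) by (intro sum.remove) auto
  have ukk: "u k k x = 1" "v k k x = 0" using nz by (auto simp: u_def v_def \<rho>_def)
  have s0: "(\<Sum>j\<le>n. (r j x)\<^sup>2) = \<rho>\<^sup>2 * (1 + su)"
    unfolding split rj ukk su_def by (simp add: power_mult_distrib sum_distrib_left distrib_left)
  have s1: "(\<Sum>j\<le>n. r j x * r' j x) = \<rho>\<^sup>2 * suv + \<rho> * \<rho>' * (1 + su)"
  proof -
    have "r j x * r' j x = \<rho>\<^sup>2 * (u k j x * v k j x) + \<rho> * \<rho>' * (u k j x)\<^sup>2" for j
      unfolding rj r'j by (simp add: power2_eq_square algebra_simps)
    then show ?thesis
      unfolding split su_def suv_def by (simp add: ukk sum.distrib sum_distrib_left algebra_simps)
  qed
  have s2: "(\<Sum>j\<le>n. (r' j x)\<^sup>2) = \<rho>\<^sup>2 * sv + 2 * \<rho> * \<rho>' * suv + \<rho>'\<^sup>2 * (1 + su)"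
  proof -
    have "(r' j x)\<^sup>2 = \<rho>\<^sup>2 * (v k j x)\<^sup>2 + 2 * \<rho> * \<rho>' * (u k j x * v k j x) + \<rho>'\<^sup>2 * (u k j x)\<^sup>2" for j
      unfolding r'j by (simp add: power2_eq_square algebra_simps)
    then show ?thesis
      unfolding split su_def suv_def sv_def by (simp add: ukk sum.distrib sum_distrib_left algebra_simps)
  qed
  \<comment> \<open>The squared determinant \<rho>^4 of the triangular change comes out, and \<rho>'
    drops out. Its square root \<rho>^2 then cancels against the factor in the denominator, so the
    sign of \<open>r k x\<close> does not matter.\<close>
  have "(\<Sum>j\<le>n. (r' j x)\<^sup>2) * (\<Sum>j\<le>n. (r j x)\<^sup>2) - (\<Sum>j\<le>n. r j x * r' j x)\<^sup>2 = (\<rho>\<^sup>2)\<^sup>2 * gram k x"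
    unfolding s0 s1 s2 gram_def su_def[symmetric] sv_def[symmetric] suv_def[symmetric] by algebra
  then have "g_density n f x = \<rho>\<^sup>2 * sqrt (gram k x) / (pi * (\<rho>\<^sup>2 * (1 + su)))"
    unfolding g_density_eq s0 by (simp only: real_sqrt_mult real_sqrt_abs abs_power2)
  then show ?thesis
    using nz by (simp add: su_def)
qed

text \<open>Exchanging the integrals over x and over the remaining coefficients leaves, at each x, a
  Gaussian expectation that is already known in closed form. The exchange rests on joint
  measurability of \<open>h\<close> and \<open>h'\<close> in coefficients and point, read off from
  their explicit sums.\<close>

lemma nn_integral_N_subset_U:
  assumes k: "k \<le> n" and A [measurable]: "A \<in> sets borel" and AU: "A \<subseteq> U k"
  shows "(\<integral>\<^sup>+w. N A w \<partial>gauss) = (\<integral>\<^sup>+x. ennreal (g_density n f x) * indicator A x \<partial>lborel)"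
proof -
  interpret pair_sigma_finite "gauss_except k" lborel
    by (intro pair_sigma_finite.intro std_gauss_product.sigma_finite lborel.sigma_finite_measure_axioms) simp
  have u: "u k j \<in> borel_measurable borel" if "j \<le> n" for j
    unfolding u_def using k that by measurable
  have v: "v k j \<in> borel_measurable borel" if "j \<le> n" for j
    unfolding v_def using k that by measurable
  have comp: "(\<lambda>p. fst p j) \<in> borel_measurable (gauss_except k \<Otimes>\<^sub>M lborel)" if "j \<in> {..n} - {k}" for j
    using that by measurable
  have h: "(\<lambda>p. h k (fst p) (snd p)) \<in> borel_measurable (gauss_except k \<Otimes>\<^sub>M lborel)"
    unfolding h_def
    by (intro borel_measurable_uminus borel_measurable_sum borel_measurable_times comp
        measurable_compose[OF measurable_snd]) (auto intro: u)
  have h': "(\<lambda>p. h' k (fst p) (snd p)) \<in> borel_measurable (gauss_except k \<Otimes>\<^sub>M lborel)"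
    unfolding h'_def
    by (intro borel_measurable_uminus borel_measurable_sum borel_measurable_times comp
        measurable_compose[OF measurable_snd]) (auto intro: v)
  have "(\<integral>\<^sup>+w. N A w \<partial>gauss) = (\<integral>\<^sup>+w. (\<integral>\<^sup>+y. N A (w(k := y)) \<partial>std_gauss) \<partial>gauss_except k)"
    by (rule nn_integral_gauss_except[OF k]) measurable
  also have "\<dots> = (\<integral>\<^sup>+w. (\<integral>\<^sup>+x. ennreal (std_normal_density (h k w x) * \<bar>h' k w x\<bar>) * indicator A x \<partial>lborel) \<partial>gauss_except k)"
    by (simp only: nn_integral_N_section[OF k A AU])
  also have "\<dots> = (\<integral>\<^sup>+x. (\<integral>\<^sup>+w. ennreal (std_normal_density (h k w x) * \<bar>h' k w x\<bar>) * indicator A x \<partial>gauss_except k) \<partial>lborel)"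
    using h h' by (intro Fubini'[symmetric]) (simp add: case_prod_beta')
  also have "\<dots> = (\<integral>\<^sup>+x. ennreal (g_density n f x) * indicator A x \<partial>lborel)"
  proof (rule nn_integral_cong)
    fix x :: real
    have "(\<integral>\<^sup>+w. ennreal (std_normal_density (h k w x) * \<bar>h' k w x\<bar>) * indicator A x \<partial>gauss_except k)
      = (\<integral>\<^sup>+w. ennreal (std_normal_density (h k w x) * \<bar>h' k w x\<bar>) \<partial>gauss_except k) * indicator A x"
      unfolding h_def h'_def by (intro nn_integral_multc) measurable
    also have "\<dots> = ennreal (g_density n f x) * indicator A x"
      using AU by (auto simp: nn_integral_density_abs_h g_density_eq_gram[OF k] subset_iff split: split_indicator)
    finally show "(\<integral>\<^sup>+w. ennreal (std_normal_density (h k w x) * \<bar>h' k w x\<bar>) * indicator A x \<partial>gauss_except k)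
      = ennreal (g_density n f x) * indicator A x" .
  qed
  finally show ?thesis .
qed

section \<open>Assembling the pieces\<close>

lemma N_disjoint_UN:
  fixes I :: "nat set"
  assumes "finite I" "disjoint_family_on A I"
  shows "N (\<Union>i\<in>I. A i) w = (\<Sum>i\<in>I. N (A i) w)"
proof (cases "\<forall>m::nat. finite ({- real m<..real m} \<inter> {x. Q w x = 0})")
  case True
  have "emeasure (count_space UNIV) (\<Union>i\<in>I. A i \<inter> {x. Q w x = 0})
      = (\<Sum>i\<in>I. emeasure (count_space UNIV) (A i \<inter> {x. Q w x = 0}))"
    using assms by (intro sum_emeasure[symmetric]) (auto simp: disjoint_family_on_def)
  moreover have "(\<Union>i\<in>I. A i) \<inter> {x. Q w x = 0} = (\<Union>i\<in>I. A i \<inter> {x. Q w x = 0})" by blast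
  ultimately show ?thesis
    unfolding N_def if_P[OF True] by (simp only:)
next
  case False
  then have "N A w = 0" for A unfolding N_def by (rule if_not_P)
  then show ?thesis by simp
qed

lemma N_mono: "A \<subseteq> B \<Longrightarrow> N A w \<le> N B w"
  unfolding N_def by (auto intro!: emeasure_mono)

lemma N_Un_le: "N (A \<union> B) w \<le> N A w + N B w"
  unfolding N_def using emeasure_subadditive[of "A \<inter> {x. Q w x = 0}" "count_space UNIV" "B \<inter> {x. Q w x = 0}"]
  by (auto simp: Int_Un_distrib2)

text \<open>Each point of \<open>A\<close> is assigned to the first k with \<open>r k x\<close>
  nonzero. On every piece the density is the same \<open>g_density\<close>, so the finitely many
  integrals add up to one over \<open>A\<close>.\<close>

lemma nn_integral_N:
  assumes A [measurable]: "A \<in> sets borel" and AU: "A \<subseteq> (\<Union>k\<le>n. U k)"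
  shows "(\<integral>\<^sup>+w. N A w \<partial>gauss) = (\<integral>\<^sup>+x. ennreal (g_density n f x) * indicator A x \<partial>lborel)"
proof -
  define B where "B k = A \<inter> disjointed U k" for k
  have disj: "disjoint_family_on B {..n}"
    using disjoint_family_disjointed[of U] unfolding B_def disjoint_family_on_def by blast
  have B: "B k \<in> sets borel" if "k \<le> n" for k
    unfolding B_def disjointed_def using that open_U by (intro sets.Int sets.Diff sets.finite_UN A) auto
  have BU: "B k \<subseteq> U k" for k
    unfolding B_def using disjointed_subset[of U k] by blast
  have "(\<Union>k\<le>n. B k) = A \<inter> (\<Union>k\<le>n. disjointed U k)"
    unfolding B_def by blast
  also have "(\<Union>k\<le>n. disjointed U k) = (\<Union>k\<le>n. U k)"
    using finite_UN_disjointed_eq[where A = U and n = "Suc n"]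
    by (simp only: atLeast0LessThan lessThan_Suc_atMost)
  finally have un: "(\<Union>k\<le>n. B k) = A"
    using AU by (simp only: Int_absorb2)
  have "(\<integral>\<^sup>+w. N A w \<partial>gauss) = (\<integral>\<^sup>+w. (\<Sum>k\<le>n. N (B k) w) \<partial>gauss)"
    using N_disjoint_UN[OF _ disj] un by simp
  also have "\<dots> = (\<Sum>k\<le>n. \<integral>\<^sup>+w. N (B k) w \<partial>gauss)"
    using B by (intro nn_integral_sum measurable_N) auto
  also have "\<dots> = (\<Sum>k\<le>n. \<integral>\<^sup>+x. ennreal (g_density n f x) * indicator (B k) x \<partial>lborel)"
    using B BU by (intro sum.cong nn_integral_N_subset_U) auto
  also have "\<dots> = (\<integral>\<^sup>+x. (\<Sum>k\<le>n. ennreal (g_density n f x) * indicator (B k) x) \<partial>lborel)"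
    using B by (intro nn_integral_sum[symmetric]) auto
  also have "\<dots> = (\<integral>\<^sup>+x. ennreal (g_density n f x) * indicator A x \<partial>lborel)"
    unfolding un[symmetric] indicator_UN_disjoint[OF finite_atMost disj] sum_distrib_left ..
  finally show ?thesis .
qed

section \<open>Multiplicities\<close>

lemma has_derivative_Q: "(Q w has_real_derivative Q' w x) (at x)"
  unfolding Q_def Q'_def by (intro DERIV_sum DERIV_cmult has_derivative_r) auto

text \<open>Without double zeros every multiplicity is 1, so counting with multiplicity is counting
  points.\<close>

lemma zero_count_eq_N:
  assumes simple: "\<And>k x. k \<le> n \<Longrightarrow> x \<in> U k \<Longrightarrow> Q (\<lambda>j. \<eta> j \<omega>) x = 0 \<Longrightarrow> Q' (\<lambda>j. \<eta> j \<omega>) x \<noteq> 0"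
    and \<Omega>: "\<Omega> \<subseteq> (\<Union>k\<le>n. U k)"
  shows "zero_count (random_sum n f \<eta> \<omega>) (complex_of_real ` \<Omega>) = N \<Omega> (\<lambda>j. \<eta> j \<omega>)"
proof (cases "\<Omega> = {}")
  case True
  then show ?thesis by (simp add: zero_count_def N_def nn_integral_empty)
next
  case False
  let ?P = "random_sum n f \<eta> \<omega>" and ?w = "\<lambda>j. \<eta> j \<omega>"
  obtain x0 k where x0: "x0 \<in> \<Omega>" "k \<le> n" "x0 \<in> U k" using False \<Omega> by blast
  \<comment> \<open>A \<open>Q\<close> vanishing identically would have a double zero at
    \<open>x0\<close>, against the hypothesis. This excludes both the infinite multiplicity of the
    zero function and the default value of \<open>N\<close>; it takes a point of \<Omega>, hence the
    separate empty case.\<close>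
  have "\<exists>x1. Q ?w x1 \<noteq> 0"
  proof (rule ccontr)
    assume "\<not> (\<exists>x1. Q ?w x1 \<noteq> 0)"
    then have "Q ?w = (\<lambda>_. 0)" by blast
    then have "((\<lambda>_. 0) has_real_derivative Q' ?w x0) (at x0)" "Q ?w x0 = 0"
      using has_derivative_Q[of ?w x0] by auto
    then show False
      using simple[OF x0(2,3)] DERIV_unique DERIV_const by blast
  qed
  then obtain x1 where x1: "Q ?w x1 \<noteq> 0" by blast
  have nz: "\<not> (\<forall>z. ?P z = 0)"
    using x1 random_sum_of_real[of \<eta> \<omega> x1] by (metis of_real_eq_0_iff)
  have mult: "zero_multiplicity ?P z = 1" if z: "z \<in> {z \<in> complex_of_real ` \<Omega>. ?P z = 0}" for z
  proof -
    obtain x where x: "x \<in> \<Omega>" "z = complex_of_real x" using z by auto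
    obtain k where k: "k \<le> n" "x \<in> U k" using x \<Omega> by auto
    have "Q ?w x = 0" using z x by (simp add: random_sum_of_real)
    then have "deriv ?P z \<noteq> 0"
      using simple[OF k] x by (simp add: deriv_random_sum_of_real)
    then have "zorder ?P z = 1"
      using z by (intro zorder_zero_eqI[OF random_sum_holomorphic open_UNIV]) auto
    then show ?thesis using nz by (simp add: zero_multiplicity_def)
  qed
  have "zero_count ?P (complex_of_real ` \<Omega>) = (\<integral>\<^sup>+z. 1 \<partial>count_space {z \<in> complex_of_real ` \<Omega>. ?P z = 0})"
    unfolding zero_count_def by (intro nn_integral_cong) (simp add: mult)
  also have "{z \<in> complex_of_real ` \<Omega>. ?P z = 0} = complex_of_real ` (\<Omega> \<inter> {x. Q ?w x = 0})"
    by (auto simp: random_sum_of_real)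
  also have "(\<integral>\<^sup>+z. 1 \<partial>count_space (complex_of_real ` (\<Omega> \<inter> {x. Q ?w x = 0})))
      = (\<integral>\<^sup>+x. 1 \<partial>count_space (\<Omega> \<inter> {x. Q ?w x = 0}))"
    by (rule nn_integral_bij_count_space[symmetric, of complex_of_real]) (auto simp: bij_betw_def inj_on_def)
  also have "\<dots> = emeasure (count_space UNIV) (\<Omega> \<inter> {x. Q ?w x = 0})"
    by (simp add: emeasure_count_space)
  also have "\<dots> = N \<Omega> ?w" by (rule N_eq[symmetric, OF x1])
  finally show ?thesis .
qed

end

section \<open>Transfer to the given probability space\<close>

text \<open>The count with multiplicities is identified with a measurable function only almost
  surely. The preimages under the two functions differ by subsets of a null set, and the completion
  contains these.\<close>

lemma borel_measurable_completion_cong_AE: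
  assumes g: "g \<in> borel_measurable M" and ae: "AE x in M. f x = g x"
  shows "f \<in> borel_measurable (completion M)"
proof (rule measurableI)
  fix A :: "'b set" assume A: "A \<in> sets borel"
  have null: "{x \<in> space M. P x \<and> f x \<noteq> g x} \<in> sets (completion M)" for P
  proof -
    have "AE x in M. \<not> (P x \<and> f x \<noteq> g x)" using ae by (rule AE_mp) auto
    from sets_completion_AE[OF this] show ?thesis by (simp add: pred_def)
  qed
  have "f -` A \<inter> space (completion M) = (g -` A \<inter> space M - {x \<in> space M. g x \<in> A \<and> f x \<noteq> g x})
      \<union> {x \<in> space M. f x \<in> A \<and> f x \<noteq> g x}"
    by auto
  also have "\<dots> \<in> sets (completion M)"
    using measurable_sets[OF g A] null by (intro sets.Un sets.Diff) auto
  finally show "f -` A \<inter> space (completion M) \<in> sets (completion M)" .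
qed simp

text \<open>The expectation is taken over the completion of \<open>M\<close>, since the count is
  compared with a measurable one only up to null events. This also accommodates sets \<Omega> that
  are Lebesgue but not Borel.\<close>

theorem theorem1p2:
  fixes M :: "'w measure"
    and n :: nat
    and f :: "nat \<Rightarrow> complex \<Rightarrow> complex"
    and \<eta> :: "nat \<Rightarrow> 'w \<Rightarrow> real"
  assumes "prob_space M"
    and "\<And>j. j \<le> n \<Longrightarrow> f j holomorphic_on UNIV"
    and "\<And>j x. j \<le> n \<Longrightarrow> f j (complex_of_real x) \<in> \<real>"
    and "prob_space.indep_vars M (\<lambda>_. borel) \<eta> {..n}"
    and "\<And>j. j \<le> n \<Longrightarrow> distributed M lborel (\<eta> j) std_normal_density"
  shows "(\<forall>x::real. D0 n f (complex_of_real x) = 0) \<and>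
    (\<forall>\<Omega>. \<Omega> \<in> sets lebesgue \<longrightarrow> (\<forall>x\<in>\<Omega>. B0 n f (complex_of_real x) \<noteq> 0) \<longrightarrow>
      (\<lambda>\<omega>. zero_count (random_sum n f \<eta> \<omega>) (complex_of_real ` \<Omega>))
          \<in> borel_measurable (completion M) \<and>
      (\<integral>\<^sup>+\<omega>. zero_count (random_sum n f \<eta> \<omega>) (complex_of_real ` \<Omega>) \<partial>completion M)
        = (\<integral>\<^sup>+x\<in>\<Omega>. ennreal (g_density n f x) \<partial>lebesgue))"
proof -
  interpret prob_space M by fact
  interpret real_entire_family n f
    using assms(2,3) by unfold_locales
  \<comment> \<open>The restriction to \<open>{..n}\<close> makes the coefficient vector a point of
    the product space, whose elements are fixed outside the index set. Independence and the normal
    laws say that its distribution is \<open>gauss\<close>.\<close>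
  define W where "W \<omega> = (\<lambda>j\<in>{..n}. \<eta> j \<omega>)" for \<omega>
  have rv: "random_variable borel (\<eta> j)" if "j \<le> n" for j
    using distributed_measurable[OF assms(5)[OF that]] by simp
  have W [measurable]: "W \<in> M \<rightarrow>\<^sub>M gauss"
    unfolding W_def using rv by (intro measurable_restrict) (simp add: measurable_cong_sets[OF refl sets_std_gauss])
  have "distr M (Pi\<^sub>M {..n} (\<lambda>_. borel)) W = Pi\<^sub>M {..n} (\<lambda>j. distr M borel (\<eta> j))"
    unfolding W_def using assms(4) rv by (subst indep_vars_iff_distr_eq_PiM'[symmetric]) auto
  also have "\<dots> = gauss"
  proof (intro PiM_cong refl)
    fix j assume "j \<in> {..n}"
    then have "distr M lborel (\<eta> j) = std_gauss"
      using distributed_distr_eq_density[OF assms(5)] by (simp add: std_gauss_def)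
    moreover have "distr M borel (\<eta> j) = distr M lborel (\<eta> j)"
      by (intro distr_cong) auto
    ultimately show "distr M borel (\<eta> j) = std_gauss" by simp
  qed
  also have "distr M (Pi\<^sub>M {..n} (\<lambda>_. borel)) W = distr M gauss W"
    by (intro distr_cong sets_PiM_cong) auto
  finally have law: "distr M gauss W = gauss" .
  have QW: "Q (W \<omega>) = Q (\<lambda>j. \<eta> j \<omega>)" "Q' (W \<omega>) = Q' (\<lambda>j. \<eta> j \<omega>)" for \<omega>
    unfolding Q_def Q'_def W_def by (auto simp: fun_eq_iff intro!: sum.cong)
  have NW: "N A (\<lambda>j. \<eta> j \<omega>) = N A (W \<omega>)" for A \<omega>
    unfolding N_def QW ..
  have EN: "(\<integral>\<^sup>+\<omega>. N A (W \<omega>) \<partial>M) = (\<integral>\<^sup>+x. ennreal (g_density n f x) * indicator A x \<partial>lborel)"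
    if "A \<in> sets borel" "A \<subseteq> (\<Union>k\<le>n. U k)" for A
    using nn_integral_N[OF that] nn_integral_distr[OF W, of "N A"] measurable_N[OF that(1)] law by simp
  have "AE w in gauss. \<forall>k\<in>{..n}. \<forall>x\<in>U k. Q w x = 0 \<longrightarrow> Q' w x \<noteq> 0"
    by (intro AE_finite_allI AE_gauss_no_double_zero) auto
  then have "AE w in distr M gauss W. \<forall>k\<in>{..n}. \<forall>x\<in>U k. Q w x = 0 \<longrightarrow> Q' w x \<noteq> 0"
    by (simp only: law)
  then have simple: "AE \<omega> in M. \<forall>k\<in>{..n}. \<forall>x\<in>U k. Q (W \<omega>) x = 0 \<longrightarrow> Q' (W \<omega>) x \<noteq> 0"
    by (rule AE_distrD[OF W])
  have main: "(\<lambda>\<omega>. zero_count (random_sum n f \<eta> \<omega>) (complex_of_real ` \<Omega>)) \<in> borel_measurable (completion M) \<and>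
      (\<integral>\<^sup>+\<omega>. zero_count (random_sum n f \<eta> \<omega>) (complex_of_real ` \<Omega>) \<partial>completion M)
        = (\<integral>\<^sup>+x\<in>\<Omega>. ennreal (g_density n f x) \<partial>lebesgue)"
    if \<Omega>: "\<Omega> \<in> sets lebesgue" and B0: "\<forall>x\<in>\<Omega>. B0 n f (complex_of_real x) \<noteq> 0" for \<Omega>
  proof -
    have \<Omega>U: "\<Omega> \<subseteq> (\<Union>k\<le>n. U k)"
    proof
      fix x assume "x \<in> \<Omega>"
      then have "(\<Sum>j\<le>n. (r j x)\<^sup>2) \<noteq> 0" using B0 by (simp add: B0_of_real)
      then obtain k where "k \<le> n" "r k x \<noteq> 0"
        by (metis (no_types, lifting) atMost_iff sum.neutral zero_power2)
      then show "x \<in> (\<Union>k\<le>n. U k)" by (auto simp: U_def)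
    qed
    obtain B Z Z' where BZ: "\<Omega> = B \<union> Z" "Z \<subseteq> Z'" "Z' \<in> null_sets lborel" "B \<in> sets lborel"
      using \<Omega> by (rule sets_completionE)
    \<comment> \<open>The formula is applied to the null set itself: the expected number of zeros in
      \<open>T\<close> is 0, so almost surely there is none, and the possibly non-Borel part
      \<open>Z\<close> of \<Omega> adds no zeros. Points where all \<open>r k\<close> vanish may lie
      in \<open>Z'\<close> and are cut away first.\<close>
    define T where "T = Z' \<inter> (\<Union>k\<le>n. U k)"
    have "(\<Union>k\<le>n. U k) \<in> sets borel" using open_U by (intro sets.finite_UN) auto
    then have T: "T \<in> sets borel" "T \<subseteq> (\<Union>k\<le>n. U k)" "T \<in> null_sets lborel"
      using BZ(3) unfolding T_def by (auto intro: null_set_Int2)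
    have B: "B \<in> sets borel" "B \<subseteq> (\<Union>k\<le>n. U k)" using BZ \<Omega>U by auto
    have "(\<integral>\<^sup>+\<omega>. N T (W \<omega>) \<partial>M) = 0"
      unfolding EN[OF T(1,2)] using T(3) by (rule nn_integral_null_set)
    then have "AE \<omega> in M. N T (W \<omega>) = 0"
      using T(1) by (subst (asm) nn_integral_0_iff_AE) auto
    then have ae: "AE \<omega> in M. zero_count (random_sum n f \<eta> \<omega>) (complex_of_real ` \<Omega>) = N B (W \<omega>)"
      using simple
    proof eventually_elim
      fix \<omega> assume nT: "N T (W \<omega>) = 0"
        and s: "\<forall>k\<in>{..n}. \<forall>x\<in>U k. Q (W \<omega>) x = 0 \<longrightarrow> Q' (W \<omega>) x \<noteq> 0"
      have "zero_count (random_sum n f \<eta> \<omega>) (complex_of_real ` \<Omega>) = N \<Omega> (\<lambda>j. \<eta> j \<omega>)"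
        using s \<Omega>U unfolding QW by (intro zero_count_eq_N) auto
      also have "\<dots> = N \<Omega> (W \<omega>)" by (rule NW)
      also have "\<dots> = N B (W \<omega>)"
      \<comment> \<open>\<Omega> lies between \<open>B\<close> and \<open>B \<union> T\<close>, and
        \<open>T\<close> contains no zero for this \<omega>.\<close>
      proof (rule antisym)
        have "N \<Omega> (W \<omega>) \<le> N (B \<union> T) (W \<omega>)"
          using BZ(1,2) \<Omega>U by (intro N_mono) (auto simp: T_def)
        also have "\<dots> \<le> N B (W \<omega>) + N T (W \<omega>)" by (rule N_Un_le)
        finally show "N \<Omega> (W \<omega>) \<le> N B (W \<omega>)" by (simp add: nT)
        show "N B (W \<omega>) \<le> N \<Omega> (W \<omega>)" using BZ(1) by (intro N_mono) auto
      qed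
      finally show "zero_count (random_sum n f \<eta> \<omega>) (complex_of_real ` \<Omega>) = N B (W \<omega>)" .
    qed
    have NB: "(\<lambda>\<omega>. N B (W \<omega>)) \<in> borel_measurable M"
      using measurable_compose[OF W measurable_N[OF B(1)]] .
    have "(\<integral>\<^sup>+\<omega>. zero_count (random_sum n f \<eta> \<omega>) (complex_of_real ` \<Omega>) \<partial>completion M)
       = (\<integral>\<^sup>+\<omega>. N B (W \<omega>) \<partial>M)"
      unfolding nn_integral_completion by (rule nn_integral_cong_AE[OF ae])
    also have "\<dots> = (\<integral>\<^sup>+x. ennreal (g_density n f x) * indicator B x \<partial>lborel)"
      by (rule EN[OF B])
    also have "\<dots> = (\<integral>\<^sup>+x. ennreal (g_density n f x) * indicator \<Omega> x \<partial>lborel)"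
    proof (rule nn_integral_cong_AE)
      have "AE x in lborel. x \<notin> Z'" using BZ(3) by (rule AE_not_in)
      then show "AE x in lborel. ennreal (g_density n f x) * indicator B x = ennreal (g_density n f x) * indicator \<Omega> x"
        by (rule AE_mp) (use BZ(1,2) in \<open>auto split: split_indicator\<close>)
    qed
    also have "\<dots> = (\<integral>\<^sup>+x\<in>\<Omega>. ennreal (g_density n f x) \<partial>lebesgue)"
      by (simp only: nn_integral_completion)
    finally show ?thesis
      using borel_measurable_completion_cong_AE[OF NB ae] by simp
  qed
  show ?thesis
    using main D0_of_real by blast
qed

end
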